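(* Let $P=\{y_1,\ldots,y_d\}$ be a finite partially ordered set with $d\ge1$ elements and $\hat P=P\cup\{y_0,y_{d+1}\}$, where $y_0=\hat 0$ and $y_{d+1}=\hat 1$. Then the following conditions are equivalent: (i) $\mathcal{Q}_P$ is $\mathbb{Q}$-factorial; (ii) $\mathcal{Q}_P$ is smooth; (iii) $\hat P$ possesses no very special cycle $C=(y_{i_1},\ldots,y_{i_m})$ such that $$\mu_C(y_{i_a})-\mu_C(y_{i_b})\le \operatorname{dist}_{\hat P}(y_{i_b},y_{i_a})$$ for all $1\le a,b\le m$ with $y_{i_b}<y_{i_a}$, and $$\mu_C(y_{i_a})-\mu_C(y_{i_b})\le \operatorname{dist}_{\hat P}(y_0,y_{i_a})+\operatorname{dist}_{\hat P}(y_{i_b},y_{d+1})$$ for all $1\le a,b\le m$; and $\hat P$ possesses no special path $\Gamma=(y_{i_1},\ldots,y_{i_m})$ with $y_{i_1}=y_0$ and $y_{i_m}=y_{d+1}$ such that $$\mu_\Gamma(y_{i_a})-\mu_\Gamma(y_{i_b})\le \operatorname{dist}_{\hat P}(y_{i_b},y_{i_a})$$ for all $1\le a,b\le m$ with $y_{i_b}<y_{i_a}$.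
   Context: Let $P=\{y_1,\ldots,y_d\}$ be a finite partially ordered set with $d$ elements and $\hat P=P\cup\{\hat 0,\hat 1\}$, where $\hat 0\notin P$ is adjoined as the unique minimal element and $\hat 1\notin P$ as the unique maximal element of $\hat P$. Write $y_0=\hat 0$, $y_{d+1}=\hat 1$. An edge of $\hat P$ is an edge of the Hasse diagram of $\hat P$, i.e. a pair $\{y_i,y_j\}$ with $y_i<y_j$ in $\hat P$ and no $z\in P$ with $y_i<z<y_j$. Let $\mathbf{e}_i$ be the $i$th canonical unit coordinate vector of $\mathbb{R}^d$. For an edge $e=\{y_i,y_j\}$ of $\hat P$ with $y_i<y_j$, define $\rho(e)\in\mathbb{R}^d$ by $\rho(e)=\mathbf{e}_i$ if $j=d+1$; $\rho(e)=-\mathbf{e}_j$ if $i=0$; $\rho(e)=\mathbf{e}_i-\mathbf{e}_j$ if $1\le i,j\le d$. The polytope $\mathcal{Q}_P\subset\mathbb{R}^d$ is the convex hull of $\{\rho(e): e \text{ is an edge of } \hat P\}$. A Fano polytope in $\mathbb{R}^d$ is a convex polytope of dimension $d$ with integral vertices such that the origin is the unique integer point belonging to its interior. (It is a fact that $\mathcal{Q}_P$ is a Fano polytope.) A $\mathbb{Q}$-factorial Fano polytope is a simplicial Fano polytope, i.e. one each of whose (proper) faces is a simplex. A smooth Fano polytope is a Fano polytope such that the vertices of each facet form a $\mathbb{Z}$-basis of $\mathbb{Z}^d$. A path in $\hat P$ is a sequence $\Gamma=(y_{i_1},\ldots,y_{i_m})$ of pairwise distinct elements of $\hat P$ such that $\{y_{i_j},y_{i_{j+1}}\}$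 is an edge of $\hat P$ for all $1\le j\le m-1$. A cycle in $\hat P$ is such a sequence $C=(y_{i_1},\ldots,y_{i_m})$ with $m\ge3$ for which $\{y_{i_1},y_{i_m}\}$ is also an edge of $\hat P$; for a cycle put $y_{i_{m+1}}=y_{i_1}$. A path $\Gamma=(y_{i_1},\ldots,y_{i_m})$ is special if $\#\{j: y_{i_j}<y_{i_{j+1}},\,1\le j\le m-1\}=\#\{k: y_{i_k}>y_{i_{k+1}},\,1\le k\le m-1\}$. A cycle $C=(y_{i_1},\ldots,y_{i_m})$ is special if $\#\{j: y_{i_j}<y_{i_{j+1}},\,1\le j\le m\}=\#\{k: y_{i_k}>y_{i_{k+1}},\,1\le k\le m\}$. A cycle $C=(y_{i_1},\ldots,y_{i_m})$ is very special if it is special and $\{y_0,y_{d+1}\}\not\subset\{y_{i_1},\ldots,y_{i_m}\}$. For a special path $\Gamma=(y_{i_1},\ldots,y_{i_m})$, $\mu_\Gamma:\{y_{i_1},\ldots,y_{i_m}\}\to\{0,1,2,\ldots\}$ is the unique function such that for each $1\le j\le m-1$, $\mu_\Gamma(y_{i_{j+1}})=\mu_\Gamma(y_{i_j})+1$ if $y_{i_j}<y_{i_{j+1}}$ and $\mu_\Gamma(y_{i_j})=\mu_\Gamma(y_{i_{j+1}})+1$ if $y_{i_j}>y_{i_{j+1}}$, and such that $\min_{j}\mu_\Gamma(y_{i_j})=0$. For a special cycle $C=(y_{i_1},\ldots,y_{i_m})$, $\mu_C$ is defined in the same way, with the conditions imposed for all $1\le j\le m$ (where $y_{i_{m+1}}=y_{i_1}$).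 A chain $Q\subset \hat P$ (totally ordered subset) is saturated if for consecutive elements $x<y$ of $Q$ there is no $z\in\hat P$ with $x<z<y$. For $y<z$ in $\hat P$, $\operatorname{dist}_{\hat P}(y,z)$ is the smallest integer $s$ for which there is a saturated chain $y=z_0<z_1<\cdots<z_s=z$ in $\hat P$. By convention $\operatorname{dist}_{\hat P}(y,y)=0$. *)

theory Defs
  imports "HOL-Analysis.Analysis" "HOL-Library.Extended"
begin

text \<open>
  A nonempty finite poset \<open>P\<close> is a type \<open>'n\<close> of class \<open>finite\<close> and \<open>order\<close>; it also
  indexes the coordinates of \<open>real ^ 'n\<close>, so \<open>d = CARD('n)\<close> and \<open>y\<^sub>i\<close> is identified with \<open>i\<close>.
  The poset with adjoined bounds is \<open>'n extended\<close>, whose order is the given one on the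
  elements \<open>Fin i\<close>, with least element \<open>Minf\<close> (that is \<open>y\<^sub>0\<close>) and greatest element
  \<open>Pinf\<close> (that is \<open>y\<close> with index \<open>d + 1\<close>).
\<close>

section \<open>The Hasse diagram\<close>

definition covered_by :: "'a::order \<Rightarrow> 'a \<Rightarrow> bool" where
  "covered_by x y \<longleftrightarrow> x < y \<and> \<not> (\<exists>z. x < z \<and> z < y)"

definition hasse_edge :: "'a::order \<Rightarrow> 'a \<Rightarrow> bool" where
  "hasse_edge x y \<longleftrightarrow> covered_by x y \<or> covered_by y x"

text \<open>
  The smallest length of a saturated chain from \<open>y\<close> to \<open>z\<close>; it is meaningful only for
  \<open>y \<le> z\<close>, and it is \<open>0\<close> for \<open>y = z\<close>.
\<close>

definition poset_dist :: "'a::order \<Rightarrow> 'a \<Rightarrow> nat" where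
  "poset_dist y z =
     (LEAST s. \<exists>c :: nat \<Rightarrow> 'a. c 0 = y \<and> c s = z \<and> (\<forall>k<s. covered_by (c k) (c (Suc k))))"

section \<open>The polytope of a poset\<close>

text \<open>
  An edge is given by its endpoints, the smaller one first. The last equation is
  irrelevant: no other pair is an edge, since \<open>'n\<close> is nonempty.
\<close>

fun rho :: "'n::{finite,order} extended \<Rightarrow> 'n extended \<Rightarrow> real ^ ('n::{finite,order})" where
  "rho (Fin i) Pinf = axis i 1"
| "rho Minf (Fin j) = - axis j 1"
| "rho (Fin i) (Fin j) = axis i 1 - axis j 1"
| "rho _ _ = 0"

text \<open>The argument names the poset, so that \<open>poset_polytope TYPE('n)\<close> is \<open>\<Q>\<^sub>P\<close>.\<close>

definition poset_polytope :: "'n::{finite,order} itself \<Rightarrow> (real ^ ('n::{finite,order})) set" where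
  "poset_polytope T = convex hull {rho x y | x y. covered_by x y}"

section \<open>Fano polytopes\<close>

definition integer_points :: "(real ^ 'n) set" where
  "integer_points = {x. \<forall>i. x $ i \<in> \<int>}"

definition fano_polytope :: "(real ^ 'n) set \<Rightarrow> bool" where
  "fano_polytope Q \<longleftrightarrow>
     polytope Q \<and> aff_dim Q = int CARD('n) \<and>
     {v. v extreme_point_of Q} \<subseteq> integer_points \<and>
     interior Q \<inter> integer_points = {0}"

definition Q_factorial_fano :: "(real ^ 'n) set \<Rightarrow> bool" where
  "Q_factorial_fano Q \<longleftrightarrow>
     fano_polytope Q \<and> (\<forall>F. F face_of Q \<and> F \<noteq> Q \<longrightarrow> (\<exists>k. k simplex F))"

definition int_scale :: "int \<Rightarrow> real ^ 'n \<Rightarrow> real ^ 'n" where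
  "int_scale k v = of_int k *\<^sub>R v"

lemma module_int_scale: "module int_scale"
  by unfold_locales (auto simp: int_scale_def algebra_simps)

definition lattice_basis :: "(real ^ 'n) set \<Rightarrow> bool" where
  "lattice_basis B \<longleftrightarrow>
     \<not> module.dependent int_scale B \<and> module.span int_scale B = integer_points"

definition smooth_fano :: "(real ^ 'n) set \<Rightarrow> bool" where
  "smooth_fano Q \<longleftrightarrow>
     fano_polytope Q \<and> (\<forall>F. F facet_of Q \<longrightarrow> lattice_basis {v. v extreme_point_of F})"

section \<open>Special paths and cycles\<close>

definition hasse_path :: "'a::order list \<Rightarrow> bool" where
  "hasse_path p \<longleftrightarrow> p \<noteq> [] \<and> distinct p \<and> successively hasse_edge p"

definition hasse_cycle :: "'a::order list \<Rightarrow> bool" where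
  "hasse_cycle c \<longleftrightarrow> hasse_path c \<and> length c \<ge> 3 \<and> hasse_edge (hd c) (last c)"

text \<open>The consecutive pairs; for a cycle, also the closing pair \<open>(last c, hd c)\<close>.\<close>

definition path_steps :: "'a list \<Rightarrow> ('a \<times> 'a) list" where
  "path_steps p = zip p (tl p)"

definition cycle_steps :: "'a list \<Rightarrow> ('a \<times> 'a) list" where
  "cycle_steps c = zip c (rotate1 c)"

definition balanced :: "('a::order \<times> 'a) list \<Rightarrow> bool" where
  "balanced s \<longleftrightarrow>
     length (filter (\<lambda>(x, y). x < y) s) = length (filter (\<lambda>(x, y). x > y) s)"

definition special_path :: "'a::order list \<Rightarrow> bool" where
  "special_path p \<longleftrightarrow> hasse_path p \<and> balanced (path_steps p)"

definition special_cycle :: "'a::order list \<Rightarrow> bool" where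
  "special_cycle c \<longleftrightarrow> hasse_cycle c \<and> balanced (cycle_steps c)"

definition very_special_cycle :: "'n::order extended list \<Rightarrow> bool" where
  "very_special_cycle c \<longleftrightarrow> special_cycle c \<and> \<not> {Minf, Pinf} \<subseteq> set c"

text \<open>\<open>V\<close> is the set of elements of the path or cycle, and \<open>s\<close> the list of its steps.\<close>

definition height_function :: "'a::order set \<Rightarrow> ('a \<times> 'a) list \<Rightarrow> ('a \<Rightarrow> nat) \<Rightarrow> bool" where
  "height_function V s \<mu> \<longleftrightarrow>
     \<mu> \<in> extensional V \<and>
     (\<forall>(x, y) \<in> set s. (x < y \<longrightarrow> \<mu> y = \<mu> x + 1) \<and> (x > y \<longrightarrow> \<mu> x = \<mu> y + 1)) \<and>
     Min (\<mu> ` V) = 0"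

definition mu_path :: "'a::order list \<Rightarrow> 'a \<Rightarrow> nat" where
  "mu_path p = (THE \<mu>. height_function (set p) (path_steps p) \<mu>)"

definition mu_cycle :: "'a::order list \<Rightarrow> 'a \<Rightarrow> nat" where
  "mu_cycle c = (THE \<mu>. height_function (set c) (cycle_steps c) \<mu>)"

text \<open>The two descriptions do determine a function.\<close>

definition step_sign :: "'a::order \<Rightarrow> 'a \<Rightarrow> int" where
  "step_sign x y = (if x < y then 1 else if x > y then - 1 else 0)"

lemma path_steps_simps [simp]:
  "path_steps [] = []" "path_steps [x] = []"
  "path_steps (x # y # p) = (x, y) # path_steps (y # p)"
  by (simp_all add: path_steps_def)

lemma path_steps_subset: "set (path_steps p) \<subseteq> set p \<times> set p"
  by (induction p rule: induct_list012) auto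

lemma cycle_steps_eq: "c \<noteq> [] \<Longrightarrow> cycle_steps c = path_steps c @ [(last c, hd c)]"
proof -
  have "zip (x # p) (p @ [z]) = path_steps (x # p) @ [(last (x # p), z)]" for x z :: 'a and p
    by (induction p arbitrary: x) auto
  then show "c \<noteq> [] \<Longrightarrow> cycle_steps c = path_steps c @ [(last c, hd c)]"
    by (cases c) (simp_all add: cycle_steps_def)
qed

lemma balanced_iff: "balanced s \<longleftrightarrow> (\<Sum>(x, y)\<leftarrow>s. step_sign x y) = 0"
proof -
  have "(\<Sum>(x, y)\<leftarrow>s. step_sign x y) =
      int (length (filter (\<lambda>(x, y). x < y) s)) - int (length (filter (\<lambda>(x, y). x > y) s))"
    by (induction s) (auto simp: step_sign_def)
  then show ?thesis
    by (auto simp: balanced_def)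
qed

lemma path_height_exists:
  "distinct p \<Longrightarrow> \<exists>h. \<forall>(x, y) \<in> set (path_steps p). h y = h x + step_sign x y"
proof (induction p rule: induct_list012)
  case (3 x y p)
  then obtain h where h: "\<forall>(u, v) \<in> set (path_steps (y # p)). h v = h u + step_sign u v"
    by auto
  have "u \<noteq> x \<and> v \<noteq> x" if "(u, v) \<in> set (path_steps (y # p))" for u v
    using that path_steps_subset[of "y # p"] 3(3) by auto
  then have "\<forall>(u, v) \<in> set (path_steps (x # y # p)).
      (h(x := h y - step_sign x y)) v = (h(x := h y - step_sign x y)) u + step_sign u v"
    using h 3(3) by auto
  then show ?case by blast
qed auto

lemma path_height_telescope:
  assumes "p \<noteq> []" "\<forall>(x, y) \<in> set (path_steps p). h y = h x + step_sign x y"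
  shows "h (last p) = h (hd p) + (\<Sum>(x, y)\<leftarrow>path_steps p. step_sign x y)"
  using assms by (induction p rule: induct_list012) auto

lemma path_height_diff:
  fixes h g :: "'a::order \<Rightarrow> int"
  assumes "\<forall>(x, y) \<in> set (path_steps p). h y = h x + step_sign x y"
    and "\<forall>(x, y) \<in> set (path_steps p). g y = g x + step_sign x y"
    and "x \<in> set p"
  shows "h x - g x = h (hd p) - g (hd p)"
  using assms by (induction p rule: induct_list012) auto

lemma height_function_unique_if:
  fixes p :: "'a::order list"
  assumes p: "p \<noteq> []" and sub: "set (path_steps p) \<subseteq> set s" "set s \<subseteq> set p \<times> set p"
    and neq: "\<forall>(x, y) \<in> set s. x < y \<or> x > y"
    and h: "\<forall>(x, y) \<in> set s. h y = h x + step_sign x y"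
  shows "\<exists>!\<mu>. height_function (set p) s \<mu>"
proof -
  define m where "m = Min (h ` set p)"
  define \<mu> where "\<mu> = restrict (\<lambda>x. nat (h x - m)) (set p)"
  have m: "m \<le> h x" if "x \<in> set p" for x
    using that by (simp add: m_def)
  have "m \<in> h ` set p"
    using p by (simp add: m_def)
  then have "0 \<in> \<mu> ` set p"
    by (force simp: \<mu>_def)
  then have "Min (\<mu> ` set p) = 0"
    using Min_le[of "\<mu> ` set p" 0] by simp
  moreover have "(x < y \<longrightarrow> \<mu> y = \<mu> x + 1) \<and> (x > y \<longrightarrow> \<mu> x = \<mu> y + 1)"
    if "(x, y) \<in> set s" for x y
  proof -
    have "x \<in> set p" "y \<in> set p" "h y = h x + step_sign x y"
      using that sub h by auto
    then show ?thesis
      using m[of x] m[of y] by (auto simp: \<mu>_def step_sign_def)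
  qed
  moreover have "\<mu> \<in> extensional (set p)"
    by (simp add: \<mu>_def)
  ultimately have ex: "height_function (set p) s \<mu>"
    unfolding height_function_def by blast
  have "\<nu> = \<nu>'" if \<nu>: "height_function (set p) s \<nu>" and \<nu>': "height_function (set p) s \<nu>'"
    for \<nu> \<nu>'
  proof -
    have st: "\<forall>(x, y) \<in> set (path_steps p). int (f y) = int (f x) + step_sign x y"
      if "height_function (set p) s f" for f
      using that sub(1) neq unfolding height_function_def step_sign_def by fastforce
    have d: "int (\<nu> x) - int (\<nu>' x) = int (\<nu> (hd p)) - int (\<nu>' (hd p))" if "x \<in> set p" for x
      using path_height_diff[OF st[OF \<nu>] st[OF \<nu>'] that] .
    have "0 \<in> f ` set p" if "height_function (set p) s f" for f
      using that p Min_in[of "f ` set p"] by (simp add: height_function_def)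
    then obtain a b where "a \<in> set p" "\<nu> a = 0" "b \<in> set p" "\<nu>' b = 0"
      using \<nu> \<nu>' by (metis imageE)
    with d[of a] d[of b] have "int (\<nu> (hd p)) - int (\<nu>' (hd p)) = 0"
      by linarith
    then show ?thesis
      using d \<nu> \<nu>' by (intro extensionalityI[of _ "set p"]) (auto simp: height_function_def)
  qed
  with ex show ?thesis by blast
qed

lemma path_steps_comparable:
  "successively hasse_edge p \<Longrightarrow> \<forall>(x, y) \<in> set (path_steps p). x < y \<or> x > y"
  by (induction p rule: induct_list012) (auto simp: hasse_edge_def covered_by_def)

lemma mu_path_unique:
  assumes "special_path p"
  shows "\<exists>!\<mu>. height_function (set p) (path_steps p) \<mu>"
proof -
  have p: "p \<noteq> []" "distinct p" "successively hasse_edge p"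
    using assms by (auto simp: special_path_def hasse_path_def)
  obtain h where "\<forall>(x, y) \<in> set (path_steps p). h y = h x + step_sign x y"
    using path_height_exists[OF p(2)] by blast
  from height_function_unique_if[OF p(1) subset_refl path_steps_subset
      path_steps_comparable[OF p(3)] this]
  show ?thesis .
qed

lemma mu_cycle_unique:
  assumes "special_cycle c"
  shows "\<exists>!\<mu>. height_function (set c) (cycle_steps c) \<mu>"
proof -
  have c: "c \<noteq> []" "distinct c" "successively hasse_edge c" "hasse_edge (hd c) (last c)"
    and bal: "balanced (cycle_steps c)"
    using assms by (auto simp: special_cycle_def hasse_cycle_def hasse_path_def)
  obtain h where h: "\<forall>(x, y) \<in> set (path_steps c). h y = h x + step_sign x y"
    using path_height_exists[OF c(2)] by blast
  have "h (hd c) = h (last c) + step_sign (last c) (hd c)"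
    using path_height_telescope[OF c(1) h] bal by (simp add: balanced_iff cycle_steps_eq[OF c(1)])
  then have "\<forall>(x, y) \<in> set (cycle_steps c). h y = h x + step_sign x y"
    using h by (auto simp: cycle_steps_eq[OF c(1)])
  moreover have "\<forall>(x, y) \<in> set (cycle_steps c). x < y \<or> x > y"
    using path_steps_comparable[OF c(3)] c(4)
    by (auto simp: cycle_steps_eq[OF c(1)] hasse_edge_def covered_by_def)
  moreover have "set (path_steps c) \<subseteq> set (cycle_steps c)"
      "set (cycle_steps c) \<subseteq> set c \<times> set c"
    using path_steps_subset[of c] c(1) by (auto simp: cycle_steps_eq[OF c(1)])
  ultimately show ?thesis
    by (intro height_function_unique_if[OF c(1)])
qed

end

theory Submission
  imports Defs
begin

text \<open>
  Put \<open>node_vector v = axis i 1\<close> for \<open>v = Fin i\<close> and \<open>node_vector v = 0\<close> for both added bounds. Then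
  \<open>rho x y = node_vector x - node_vector y\<close> on every edge, so the vectors \<open>rho x y\<close> are the columns of
  the incidence matrix of the directed graph obtained from the Hasse diagram by gluing \<open>Minf\<close> to
  \<open>Pinf\<close>. A linear functional \<open>a\<close> is the same as a real function \<open>h v = - (a \<bullet> node_vector v)\<close> on the
  nodes with \<open>h Minf = h Pinf = 0\<close>, and \<open>a \<bullet> rho x y = h y - h x\<close>. Hence the functionals
  that are at most \<open>1\<close> on the polytope are the \<^emph>\<open>potentials\<close>: functions that agree on the two bounds
  and grow by at most \<open>1\<close> along each cover. The face on which such a functional equals \<open>1\<close> is spanned
  by the \<^emph>\<open>tight\<close> covers, where \<open>h\<close> grows by exactly \<open>1\<close>.

  The glued graph is strongly connected, so the origin is interior and every facet arises
  from a potential. All vectors \<open>rho x y\<close> are roots of the root system of type \<open>A\<close>; they have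
  the same length in a suitable inner product, so each of them is a vertex
  (\<open>extreme_points_edge_vectors\<close>) and the vertices of a facet are exactly its tight covers. If these
  are linearly independent, they form a lattice basis, because incidence matrices are
  unimodular (\<open>lattice_basis_if_independent_edge_vectors\<close>). Therefore both being smooth and being
  \<open>\<rat>\<close>-factorial amount to independence of the vertices of each facet.

  Columns of an incidence matrix are dependent exactly when their edges contain a cycle. A cycle of
  the glued graph lifts either to a cycle of the Hasse diagram through at most one of the bounds, or
  to a path from \<open>Minf\<close> to \<open>Pinf\<close>. So the polytope fails to be smooth if and only if some potential
  has a tight cycle or a tight path of this kind (\<open>dependent_edge_vectors_graph\<close>,
  \<open>dependent_facet_if_tight\<close>). On such a cycle or path the potential is the height function \<open>\<mu>\<close> up
  to a constant. Hence the cycle or path is special, and the distance inequalities say that a potential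
  cannot grow faster than the distance in the glued graph. Conversely, a function on some of the nodes
  that obeys these inequalities extends to a potential on all nodes, by the formula that extends a
  Lipschitz function from a subset of a metric space (\<open>potential_extension\<close>).
\<close>

section \<open>Saturated chains and distances\<close>

lemma ex_cover_le:
  fixes x y :: "'a::{finite,order}"
  assumes "x < y"
  shows "\<exists>z. covered_by x z \<and> z \<le> y"
proof -
  obtain z where z: "z \<in> {z. x < z \<and> z \<le> y}" "\<forall>w\<in>{z. x < z \<and> z \<le> y}. w \<le> z \<longrightarrow> z = w"
    using finite_has_minimal[of "{z. x < z \<and> z \<le> y}"] assms by auto
  have "covered_by x z"
    unfolding covered_by_def using z by (auto dest: order.strict_trans2)
  with z show ?thesis by blast
qed

lemma le_imp_saturated_chain:
  fixes x y :: "'a::{finite,order}"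
  assumes "x \<le> y"
  shows "covered_by\<^sup>*\<^sup>* x y"
  using assms
proof (induction "card {z. x < z}" arbitrary: x rule: less_induct)
  case less
  show ?case
  proof (cases "x = y")
    case False
    then obtain z where z: "covered_by x z" "z \<le> y"
      using ex_cover_le less.prems by (metis order.not_eq_order_implies_strict)
    then have "{w. z < w} \<subset> {w. x < w}"
      by (auto simp: covered_by_def)
    then have "covered_by\<^sup>*\<^sup>* z y"
      using less.hyps z(2) by (simp add: psubset_card_mono)
    with z show ?thesis by (metis converse_rtranclp_into_rtranclp)
  qed auto
qed

lemma poset_dist_eq: "poset_dist y z = (LEAST s. (covered_by ^^ s) y z)"
  unfolding poset_dist_def relpowp_fun_conv ..

lemma poset_dist_chain:
  fixes x y :: "'a::{finite,order}"
  assumes "x \<le> y"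
  shows "(covered_by ^^ poset_dist x y) x y"
  using rtranclp_imp_relpowp[OF le_imp_saturated_chain[OF assms]]
  unfolding poset_dist_eq by (metis LeastI)

lemma poset_dist_le: "(covered_by ^^ s) x y \<Longrightarrow> poset_dist x y \<le> s"
  unfolding poset_dist_eq by (rule Least_le)

lemma poset_dist_refl [simp]: "poset_dist x x = 0"
  using poset_dist_le[of 0 x x] by simp

lemma poset_dist_cover:
  fixes x y z :: "'a::{finite,order}"
  assumes "x \<le> y" "covered_by y z"
  shows "poset_dist x z \<le> Suc (poset_dist x y)"
  using poset_dist_chain[OF assms(1)] assms(2) by (intro poset_dist_le) auto

instance extended :: (finite) finite
proof
  have "(UNIV :: 'a extended set) = insert Minf (insert Pinf (range Fin))"
    by (auto intro: extended.exhaust)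
  then show "finite (UNIV :: 'a extended set)"
    by (metis finite finite_imageI finite_insert)
qed

section \<open>Potentials\<close>

definition potential :: "('n::order extended \<Rightarrow> real) \<Rightarrow> bool" where
  "potential h \<longleftrightarrow> h Minf = h Pinf \<and> (\<forall>x y. covered_by x y \<longrightarrow> h y \<le> h x + 1)"

text \<open>
  Tightness is symmetric in the two endpoints, since cycles and paths in the Hasse diagram may
  traverse a cover in either direction.
\<close>

definition tight :: "('n::order extended \<Rightarrow> real) \<Rightarrow> 'n extended \<Rightarrow> 'n extended \<Rightarrow> bool" where
  "tight h x y \<longleftrightarrow> covered_by x y \<and> h y = h x + 1 \<or> covered_by y x \<and> h x = h y + 1"

lemma potential_le_dist:
  fixes h :: "'n::{finite,order} extended \<Rightarrow> real"
  assumes h: "potential h" and "x \<le> y"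
  shows "h y \<le> h x + real (poset_dist x y)"
proof -
  have "(covered_by ^^ s) x y \<Longrightarrow> h y \<le> h x + real s" for s y
  proof (induction s arbitrary: y)
    case (Suc s)
    then obtain z where "(covered_by ^^ s) x z" "covered_by z y" by auto
    with Suc.IH[of z] h show ?case
      unfolding potential_def by fastforce
  qed auto
  with poset_dist_chain[OF \<open>x \<le> y\<close>] show ?thesis by blast
qed

text \<open>
  The extension sends \<open>v\<close> to the least value of \<open>\<mu> b\<close> plus the length of a walk from \<open>b \<in> S\<close> to \<open>v\<close>
  in the graph in which \<open>Minf\<close> and \<open>Pinf\<close> are glued. Shortest walks go straight up, or up
  to \<open>Pinf\<close> and then up from \<open>Minf\<close>; the assumptions say that neither kind makes the value at a
  point of \<open>S\<close> drop below \<open>\<mu>\<close>.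
\<close>

lemma potential_extension:
  fixes \<mu> :: "'n::{finite,order} extended \<Rightarrow> nat"
  assumes ne: "S \<noteq> {}"
    and up: "\<And>a b. \<lbrakk>a \<in> S; b \<in> S; b < a\<rbrakk> \<Longrightarrow> \<mu> a \<le> \<mu> b + poset_dist b a"
    and wrap: "\<And>a b. \<lbrakk>a \<in> S; b \<in> S\<rbrakk> \<Longrightarrow> \<mu> a \<le> \<mu> b + poset_dist b Pinf + poset_dist Minf a"
    and ends: "\<lbrakk>Minf \<in> S; Pinf \<in> S\<rbrakk> \<Longrightarrow> \<mu> Minf = \<mu> Pinf"
  obtains h :: "'n extended \<Rightarrow> nat" where "potential (\<lambda>v. real (h v))" "\<And>x. x \<in> S \<Longrightarrow> h x = \<mu> x"
proof
  \<comment> \<open>\<open>I v k\<close>: some walk reaches \<open>v\<close> with value at most \<open>k\<close>. In the last case the walk starts at \<open>Minf\<close>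
      and moves to \<open>Pinf\<close> at no cost.\<close>
  define I where "I v k \<longleftrightarrow> (\<exists>b\<in>S. b \<le> v \<and> \<mu> b + poset_dist b v \<le> k) \<or>
      (\<exists>b\<in>S. \<mu> b + poset_dist b Pinf + poset_dist Minf v \<le> k) \<or>
      v = Pinf \<and> Minf \<in> S \<and> \<mu> Minf \<le> k" for v k
  define h where "h v = (LEAST k. I v k)" for v
  have "\<exists>k. I v k" for v
    unfolding I_def using ne by blast
  then have I: "I v (h v)" for v
    unfolding h_def by (metis LeastI_ex)
  have h_le: "I v k \<Longrightarrow> h v \<le> k" for v k
    unfolding h_def by (rule Least_le)
  have "I Pinf k" if "I Minf k" for k
    using that unfolding I_def by fastforce
  moreover have "I Minf k" if "I Pinf k" for k
    using that unfolding I_def by fastforce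
  ultimately have "h Minf = h Pinf"
    using I h_le by (metis order.antisym)
  moreover have "h y \<le> h x + 1" if xy: "covered_by x y" for x y
  proof (rule h_le)
    from xy have neq: "x \<noteq> Pinf" "x \<le> y" by (auto simp: covered_by_def)
    from I[of x] consider b where "b \<in> S" "b \<le> x" "\<mu> b + poset_dist b x \<le> h x"
      | b where "b \<in> S" "\<mu> b + poset_dist b Pinf + poset_dist Minf x \<le> h x"
      using neq unfolding I_def by blast
    then show "I y (h x + 1)"
    proof cases
      case (1 b)
      then show ?thesis
        using poset_dist_cover[OF 1(2) xy] neq
        unfolding I_def by (intro disjI1 bexI[of _ b]) (auto intro: order.trans)
    next
      case (2 b)
      then show ?thesis
        using poset_dist_cover[of Minf x y] xy
        unfolding I_def by (intro disjI2 disjI1 bexI[of _ b]) auto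
    qed
  qed
  ultimately show "potential (\<lambda>v. real (h v))"
    by (fastforce simp: potential_def)
  show "h x = \<mu> x" if x: "x \<in> S" for x
  proof (rule order.antisym)
    show "h x \<le> \<mu> x"
      by (intro h_le) (auto simp: I_def x intro!: bexI[of _ x])
    from I[of x] consider b where "b \<in> S" "b \<le> x" "\<mu> b + poset_dist b x \<le> h x"
      | b where "b \<in> S" "\<mu> b + poset_dist b Pinf + poset_dist Minf x \<le> h x"
      | "x = Pinf" "Minf \<in> S" "\<mu> Minf \<le> h x"
      unfolding I_def by blast
    then show "\<mu> x \<le> h x"
    proof cases
      case (1 b)
      then show ?thesis using up[of x b] x by (cases "b = x") (auto simp: order.strict_iff_order)
    next
      case (2 b)
      then show ?thesis using wrap[of x b] x by auto
    next
      case 3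
      then show ?thesis using ends x by auto
    qed
  qed
qed

section \<open>The edge vectors\<close>

definition node_vector :: "'n::{finite,order} extended \<Rightarrow> (real, 'n::{finite,order}) vec" where
  "node_vector v = (case v of Fin i \<Rightarrow> axis i 1 | _ \<Rightarrow> 0)"

lemma node_vector_simps [simp]:
  "node_vector (Fin i) = axis i 1" "node_vector Minf = 0" "node_vector Pinf = 0"
  by (simp_all add: node_vector_def)

lemma not_covered_by_simps [simp]: "\<not> covered_by Pinf x" "\<not> covered_by x (Minf :: 'n::order extended)"
  "\<not> covered_by x x"
  by (auto simp: covered_by_def)

lemma not_covered_by_Minf_Pinf [simp]: "\<not> covered_by Minf (Pinf :: 'n::order extended)"
  by (auto simp: covered_by_def intro!: exI[of _ "Fin _"])

lemma rho_cover: "covered_by x y \<Longrightarrow> rho x y = node_vector x - node_vector y"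
  by (cases x; cases y) (auto simp: covered_by_def)

definition edge_vectors :: "((real, 'n::{finite,order}) vec) set" where
  "edge_vectors = {rho x y | x y. covered_by x y}"

lemma edge_vectorsI [intro]: "covered_by x y \<Longrightarrow> rho x y \<in> edge_vectors"
  by (auto simp: edge_vectors_def)

lemma edge_vectorsE:
  assumes "v \<in> edge_vectors"
  obtains x y where "v = rho x y" "covered_by x y"
  using assms by (auto simp: edge_vectors_def)

lemma poset_polytope_eq: "poset_polytope TYPE('n::{finite,order}) = convex hull edge_vectors"
  by (simp add: poset_polytope_def edge_vectors_def)

lemma finite_edge_vectors: "finite (edge_vectors :: ((real, 'n::{finite,order}) vec) set)"
proof -
  have "edge_vectors = (\<lambda>(x, y). rho x y) ` {(x :: 'n extended, y). covered_by x y}"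
    by (auto simp: edge_vectors_def)
  then show ?thesis by (metis finite finite_imageI)
qed

lemma rho_inject:
  fixes x y x' y' :: "'n::{finite,order} extended"
  assumes "covered_by x y" "covered_by x' y'" "rho x y = rho x' y'"
  shows "x = x' \<and> y = y'"
proof -
  have s: "rho x y $ i = 1 \<longleftrightarrow> x = Fin i" "rho x y $ i = - 1 \<longleftrightarrow> y = Fin i"
    if "covered_by x y" for x y :: "'n extended" and i :: 'n
    using that by (cases x; cases y; auto simp: axis_def)+
  have eq: "x = Fin i \<longleftrightarrow> x' = Fin i" "y = Fin i \<longleftrightarrow> y' = Fin i" for i
    using s[OF assms(1), of i] s[OF assms(2), of i] assms(3) by auto
  have "x = x'"
    using eq(1) assms(1,2) by (metis extended.exhaust not_covered_by_simps(1))
  moreover have "y = y'"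
    using eq(2) assms(1,2) by (metis extended.exhaust not_covered_by_simps(2))
  ultimately show ?thesis ..
qed

lemma axis_component: "axis i c $ j = (if j = i then c else 0)"
  by (simp add: axis_def)

text \<open>
  This is the standard inner product of \<open>\<real>\<^sup>d\<^sup>+\<^sup>1\<close> restricted to the hyperplane of vectors with
  coordinate sum \<open>0\<close>, written in the first \<open>d\<close> coordinates. There the edge vectors become differences
  of two distinct unit vectors, all of squared length \<open>2\<close>.
\<close>

definition root_form :: "real ^ 'n \<Rightarrow> real ^ 'n \<Rightarrow> real" where
  "root_form u v = u \<bullet> v + (u \<bullet> (\<chi> i. 1)) * (v \<bullet> (\<chi> i. 1))"

lemma root_form_edge_vector:
  assumes "v \<in> edge_vectors"
  shows "root_form v v = 2"
proof -
  obtain x y where v: "v = rho x y" "covered_by x y"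
    using assms by (rule edge_vectorsE)
  then show ?thesis
    by (cases x; cases y)
      (auto simp: root_form_def inner_axis_axis inner_axis' inner_diff_left inner_diff_right axis_component)
qed

lemma root_form_less:
  assumes "u \<in> edge_vectors" "v \<in> edge_vectors" "u \<noteq> v"
  shows "root_form u v < 2"
proof -
  have "0 < (u - v) \<bullet> (u - v)"
    using assms(3) by simp
  also have "\<dots> \<le> root_form (u - v) (u - v)"
    by (simp add: root_form_def)
  also have "\<dots> = root_form u u - 2 * root_form u v + root_form v v"
    by (simp add: root_form_def inner_diff_left inner_diff_right inner_commute algebra_simps)
  finally show ?thesis
    using assms by (simp add: root_form_edge_vector)
qed

text \<open>
  Vectors of equal length are in convex position: by the Cauchy-Schwarz inequality the functional
  \<open>root_form u\<close> reaches its maximum over the edge vectors at \<open>u\<close> only.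
\<close>

lemma extreme_points_edge_vectors:
  assumes "T \<subseteq> edge_vectors"
  shows "{v. v extreme_point_of (convex hull T)} = T"
proof -
  have "u \<notin> convex hull (T - {u})" if "u \<in> T" for u
  proof
    assume u: "u \<in> convex hull (T - {u})"
    have "root_form u v = (u + (u \<bullet> (\<chi> i. 1)) *\<^sub>R (\<chi> i. 1)) \<bullet> v" for v
      by (simp add: root_form_def inner_add_left inner_add_right inner_commute)
    then have "convex {v. root_form u v < 2}"
      by (simp add: convex_halfspace_lt)
    then have "convex hull (T - {u}) \<subseteq> {v. root_form u v < 2}"
      using assms that by (intro hull_minimal) (auto intro!: root_form_less)
    with u have "root_form u u < 2" by blast
    with assms that show False
      using root_form_edge_vector[of u] by auto
  qed
  moreover have "compact T"
    using assms finite_edge_vectors by (meson finite_imp_compact finite_subset)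
  ultimately show ?thesis
    using extreme_point_of_convex_hull_convex_independent by blast
qed

section \<open>The polytope is Fano\<close>

definition potential_functional :: "('n::{finite,order} extended \<Rightarrow> real) \<Rightarrow> (real, 'n::{finite,order}) vec" where
  "potential_functional h = (\<chi> i. h Minf - h (Fin i))"

lemma potential_functional_rho:
  assumes "h Minf = h Pinf" "covered_by x y"
  shows "potential_functional h \<bullet> rho x y = h y - h x"
proof -
  have "potential_functional h \<bullet> node_vector v = h Minf - h v" for v
    using assms(1) by (cases v) (auto simp: potential_functional_def inner_axis)
  with assms(2) show ?thesis
    by (simp add: rho_cover inner_diff_right)
qed

lemma monotone_potential_eq:
  fixes h :: "'n::{finite,order} extended \<Rightarrow> real"
  assumes mono: "\<And>x y. covered_by x y \<Longrightarrow> h x \<le> h y" and ends: "h Minf = h Pinf"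
  shows "h v = h Minf"
proof -
  have "covered_by\<^sup>*\<^sup>* x y \<Longrightarrow> h x \<le> h y" for x y
    by (induction rule: rtranclp_induct) (auto intro: order.trans mono)
  then have "h x \<le> h y" if "x \<le> y" for x y
    using that le_imp_saturated_chain by blast
  then show ?thesis
    using ends by (metis Minf_le le_Pinf order.antisym)
qed

text \<open>
  A functional that is nonnegative on all edge vectors corresponds to a function that is monotone
  along covers but takes the same value at the two bounds, hence is constant.
\<close>

lemma functional_zero_if_nonneg:
  assumes "\<And>v. v \<in> edge_vectors \<Longrightarrow> 0 \<le> a \<bullet> v"
  shows "a = 0"
proof -
  define h where "h x = - (a \<bullet> node_vector x)" for x
  have "h x \<le> h y" if "covered_by x y" for x y
    using assms[OF edge_vectorsI[OF that]] by (simp add: h_def rho_cover[OF that] inner_diff_right)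
  then have "h x = h Minf" for x
    by (rule monotone_potential_eq) (auto simp: h_def)
  from this[of "Fin _"] show ?thesis
    by (simp add: h_def inner_axis vec_eq_iff)
qed

text \<open>
  Otherwise some hyperplane through the origin would have the whole polytope on one side.
\<close>

lemma zero_in_interior: "0 \<in> interior (convex hull (edge_vectors :: ((real, 'n::{finite,order}) vec) set))"
proof (rule ccontr)
  let ?Q = "convex hull (edge_vectors :: ((real, 'n::{finite,order}) vec) set)"
  assume "0 \<notin> interior ?Q"
  have "\<exists>a. a \<noteq> 0 \<and> (\<forall>x\<in>?Q. 0 \<le> a \<bullet> x)"
  proof (cases "interior ?Q = {}")
    case True
    then obtain a b where a: "a \<noteq> 0" "?Q \<subseteq> {x. a \<bullet> x = b}"
      using empty_interior_subset_hyperplane[of ?Q] convex_convex_hull by metis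
    show ?thesis
    proof (cases "b \<ge> 0")
      case True
      with a show ?thesis by (intro exI[of _ a]) auto
    next
      case False
      with a show ?thesis by (intro exI[of _ "- a"]) auto
    qed
  next
    case False
    obtain a where a: "a \<noteq> 0" "\<forall>x\<in>interior ?Q. 0 \<le> a \<bullet> x"
      using separating_hyperplane_set_0[of "interior ?Q"] \<open>0 \<notin> interior ?Q\<close>
      by (auto simp: convex_interior)
    then have "closure (interior ?Q) \<subseteq> {x. 0 \<le> a \<bullet> x}"
      by (intro closure_minimal closed_halfspace_ge) auto
    then have "?Q \<subseteq> {x. 0 \<le> a \<bullet> x}"
      using convex_closure_interior[of ?Q] False closure_subset[of ?Q] by auto
    with a show ?thesis by blast
  qed
  then obtain a where "a \<noteq> 0" "\<forall>x\<in>?Q. 0 \<le> a \<bullet> x" by blast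
  then show False
    using functional_zero_if_nonneg[of a] hull_inc[of _ edge_vectors convex] by blast
qed

lemma edge_vectors_integral:
  assumes "v \<in> edge_vectors"
  shows "v \<in> integer_points" "\<bar>v $ i\<bar> \<le> 1"
proof -
  obtain x y where v: "v = rho x y" "covered_by x y"
    using assms by (rule edge_vectorsE)
  have "rho x y $ i \<in> \<int> \<and> \<bar>rho x y $ i\<bar> \<le> 1" for i
    using v(2) by (cases x; cases y) (auto simp: axis_def)
  with v show "v \<in> integer_points" "\<bar>v $ i\<bar> \<le> 1"
    by (auto simp: integer_points_def)
qed

lemma interior_point_coordinate:
  fixes x :: "(real, 'n::{finite,order}) vec"
  assumes x: "x \<in> interior (convex hull edge_vectors)"
  shows "\<bar>x $ i\<bar> < 1"
proof -
  have half: "interior (convex hull edge_vectors) \<subseteq> {x. a \<bullet> x < 1}"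
    if "a \<noteq> 0" "\<And>v. v \<in> edge_vectors \<Longrightarrow> a \<bullet> v \<le> 1" for a :: "(real, 'n) vec"
  proof -
    have "convex hull edge_vectors \<subseteq> {x. a \<bullet> x \<le> 1}"
      using that(2) by (intro hull_minimal) (auto simp: convex_halfspace_le)
    from interior_mono[OF this] that(1) show ?thesis by simp
  qed
  have "axis i (1::real) \<noteq> 0" by simp
  moreover have "- axis i (1::real) \<noteq> 0" by simp
  ultimately have "axis i 1 \<bullet> x < 1" "- axis i 1 \<bullet> x < 1"
    using half[of "axis i 1"] half[of "- axis i 1"] x edge_vectors_integral(2)[where i = i]
    by (force simp: inner_axis' abs_le_iff minus_le_iff)+
  then show ?thesis by (simp add: inner_axis')
qed

lemma aff_dim_poset_polytope:
  "aff_dim (convex hull (edge_vectors :: ((real, 'n::{finite,order}) vec) set)) = int CARD('n)"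
  using zero_in_interior[where 'n = 'n] affine_hull_nonempty_interior
  by (metis DIM_cart DIM_real aff_dim_UNIV aff_dim_affine_hull empty_iff mult.right_neutral)

lemma fano_poset_polytope: "fano_polytope (convex hull (edge_vectors :: ((real, 'n::{finite,order}) vec) set))"
  unfolding fano_polytope_def
proof (intro conjI)
  show "polytope (convex hull (edge_vectors :: ((real, 'n) vec) set))"
    using finite_edge_vectors by (auto simp: polytope_def)
  show "{v. v extreme_point_of (convex hull (edge_vectors :: ((real, 'n) vec) set))} \<subseteq> integer_points"
    using extreme_points_edge_vectors[OF subset_refl] edge_vectors_integral(1) by auto
  have "x = 0" if "x \<in> interior (convex hull edge_vectors)" "x \<in> integer_points" for x :: "(real, 'n) vec"
  proof -
    have "x $ i = 0" for i
      using interior_point_coordinate[OF that(1), of i] that(2)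
      by (auto simp: integer_points_def Ints_def abs_less_iff dest!: spec[of _ i])
    then show ?thesis by (simp add: vec_eq_iff)
  qed
  then show "interior (convex hull (edge_vectors :: ((real, 'n) vec) set)) \<inter> integer_points = {0}"
    using zero_in_interior by (auto simp: integer_points_def)
qed (rule aff_dim_poset_polytope)

section \<open>Facets and potentials\<close>

text \<open>
  Since the origin is interior, the functional that defines a facet can be scaled to equal \<open>1\<close> on it.
  The last property counts vertices: a facet has dimension \<open>d - 1\<close>.
\<close>

lemma poset_polytope_facetE:
  fixes F :: "((real, 'n::{finite,order}) vec) set"
  assumes F: "F facet_of (convex hull edge_vectors)"
  obtains T h a where "T \<subseteq> edge_vectors" "F = convex hull T" "{v. v extreme_point_of F} = T"
    "potential h" "\<And>x y. \<lbrakk>covered_by x y; rho x y \<in> T\<rbrakk> \<Longrightarrow> h y = h x + 1"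
    "\<And>v. v \<in> T \<Longrightarrow> a \<bullet> v = 1" "CARD('n) \<le> card T"
proof -
  let ?Q = "convex hull (edge_vectors :: ((real, 'n) vec) set)"
  have "F face_of ?Q" and ne: "F \<noteq> ?Q" and dim: "aff_dim F = aff_dim ?Q - 1"
    using F facet_of_irrefl by (auto simp: facet_of_def)
  obtain T where T: "T \<subseteq> edge_vectors" "F = convex hull T"
    using face_of_convex_hull_subset[OF finite_imp_compact[OF finite_edge_vectors] \<open>F face_of ?Q\<close>]
    by metis
  have finT: "finite T"
    using T(1) finite_edge_vectors finite_subset by blast
  have "polyhedron ?Q"
    by (intro polytope_imp_polyhedron polytope_convex_hull finite_edge_vectors)
  then obtain c b where c: "?Q \<subseteq> {x. c \<bullet> x \<le> b}" "F = ?Q \<inter> {x. c \<bullet> x = b}"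
    using facet_of_polyhedron F by metis
  have "0 \<in> ?Q"
    using zero_in_interior interior_subset by blast
  have "0 \<notin> F"
    using face_of_disjoint_interior[OF \<open>F face_of ?Q\<close> ne] zero_in_interior by blast
  then have "b > 0"
    using c \<open>0 \<in> ?Q\<close> by (force simp: order.order_iff_strict)
  define a where "a = (1 / b) *\<^sub>R c"
  define h where "h x = - (a \<bullet> node_vector x)" for x
  have rho: "a \<bullet> rho x y = h y - h x" if "covered_by x y" for x y
    using that by (simp add: rho_cover h_def inner_diff_right)
  have le: "a \<bullet> v \<le> 1" if "v \<in> edge_vectors" for v
    using c(1) that hull_inc[of v edge_vectors convex] \<open>b > 0\<close> by (auto simp: a_def)
  have eq: "a \<bullet> v = 1" if "v \<in> T" for v
    using c(2) T(2) that hull_inc[of v T convex] \<open>b > 0\<close> by (auto simp: a_def)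
  show ?thesis
  proof
    show "{v. v extreme_point_of F} = T"
      using extreme_points_edge_vectors[OF T(1)] T(2) by simp
    show "potential h"
      unfolding potential_def
    proof (intro conjI allI impI)
      fix x y :: "'n extended"
      assume xy: "covered_by x y"
      show "h y \<le> h x + 1"
        using le[OF edge_vectorsI[OF xy]] rho[OF xy] by simp
    qed (simp add: h_def)
    show "h y = h x + 1" if "covered_by x y" "rho x y \<in> T" for x y
      using rho[OF that(1)] eq[OF that(2)] by simp
    have "int CARD('n) - 1 \<le> int (card T) - 1"
      using dim aff_dim_le_card[OF finT] unfolding T(2) aff_dim_poset_polytope
      by (simp add: aff_dim_convex_hull)
    then show "CARD('n) \<le> card T" by simp
  qed (use T eq in auto)
qed

text \<open>
  The points where the functional of \<open>h\<close> equals \<open>1\<close> form a proper face, which may be too small to be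
  a facet; any facet above it still has the tight edge vectors among its vertices.
\<close>

lemma tight_facet_exists:
  fixes h :: "'n::{finite,order} extended \<Rightarrow> real"
  assumes h: "potential h" and uv: "covered_by u v" "h v = h u + 1"
  obtains F where "F facet_of (convex hull edge_vectors)"
    "\<And>x y. \<lbrakk>covered_by x y; h y = h x + 1\<rbrakk> \<Longrightarrow> rho x y extreme_point_of F"
proof -
  let ?Q = "convex hull (edge_vectors :: ((real, 'n) vec) set)"
  let ?a = "potential_functional h"
  define G where "G = ?Q \<inter> {x. ?a \<bullet> x = 1}"
  have rho: "?a \<bullet> rho x y = h y - h x" if "covered_by x y" for x y
    using h that by (simp add: potential_def potential_functional_rho)
  have "?Q \<subseteq> {x. ?a \<bullet> x \<le> 1}"
    using h rho by (intro hull_minimal) (force elim: edge_vectorsE simp: convex_halfspace_le potential_def)+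
  then have G: "G face_of ?Q"
    unfolding G_def by (intro face_of_Int_supporting_hyperplane_le) auto
  have inG: "rho x y \<in> G" if "covered_by x y" "h y = h x + 1" for x y
    unfolding G_def using that rho by (auto intro!: hull_inc)
  have "0 \<in> ?Q"
    using zero_in_interior interior_subset by blast
  moreover have "0 \<notin> G"
    by (simp add: G_def)
  ultimately have "G \<noteq> ?Q"
    by metis
  moreover have "polyhedron ?Q"
    by (intro polytope_imp_polyhedron polytope_convex_hull finite_edge_vectors)
  moreover have "G \<noteq> {}"
    using inG uv by blast
  ultimately obtain F where F: "F facet_of ?Q" "G \<subseteq> F"
    using face_of_polyhedron_subset_facet G by metis
  show ?thesis
  proof
    fix x y :: "'n extended"
    assume xy: "covered_by x y" "h y = h x + 1"
    then have "rho x y extreme_point_of ?Q"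
      using extreme_points_edge_vectors[of edge_vectors] by blast
    then show "rho x y extreme_point_of F"
      using inG[OF xy] F extreme_point_of_face[OF facet_of_imp_face_of[OF F(1)]] by blast
  qed (rule F(1))
qed

section \<open>Independence and lattice bases\<close>

text \<open>
  Let \<open>L\<close> be the integer span of \<open>T\<close>. If \<open>rho x y \<in> T\<close> then
  \<open>node_vector x \<in> L\<close> if and only if \<open>node_vector y \<in> L\<close>. So the indicator \<open>z\<close> of the coordinates \<open>i\<close> with
  \<open>axis i 1 \<notin> L\<close> is orthogonal to \<open>T\<close>. As \<open>T\<close> spans the whole space, \<open>z = 0\<close>.
\<close>

lemma lattice_basis_if_independent_edge_vectors:
  fixes T :: "(real, 'n::{finite,order}) vec set"
  assumes T: "T \<subseteq> edge_vectors" and indep: "independent T" and card: "CARD('n) \<le> card T"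
  shows "lattice_basis T"
proof -
  interpret Z: module "int_scale :: int \<Rightarrow> (real, 'n) vec \<Rightarrow> _"
    by (rule module_int_scale)
  have finT: "finite T"
    using T finite_edge_vectors finite_subset by blast
  have "\<not> Z.dependent T"
  proof
    assume "Z.dependent T"
    then obtain u where u: "\<exists>v\<in>T. u v \<noteq> 0" "(\<Sum>v\<in>T. int_scale (u v) v) = 0"
      using Z.dependent_finite[OF finT] by blast
    then have "(\<Sum>v\<in>T. real_of_int (u v) *\<^sub>R v) = 0" "\<exists>v\<in>T. real_of_int (u v) \<noteq> 0"
      by (auto simp: int_scale_def)
    then have "dependent T"
      unfolding dependent_finite[OF finT] by (intro exI[of _ "\<lambda>v. real_of_int (u v)"]) simp
    with indep show False ..
  qed
  moreover have "Z.span T = integer_points"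
  proof
    have "Z.subspace integer_points"
      by (auto simp: Z.subspace_def integer_points_def int_scale_def)
    then show "Z.span T \<subseteq> integer_points"
      using T edge_vectors_integral(1) by (intro Z.span_minimal) auto
    have "(UNIV :: (real, 'n) vec set) \<subseteq> span T"
      using indep card by (intro card_ge_dim_independent) auto
    have "axis i 1 \<in> Z.span T" for i
    proof -
      define z :: "(real, 'n) vec" where "z = (\<chi> j. if axis j 1 \<in> Z.span T then 0 else 1)"
      have node: "z \<bullet> node_vector x = (if node_vector x \<in> Z.span T then 0 else 1)" for x
        by (cases x) (auto simp: z_def inner_axis Z.span_zero)
      have "z \<bullet> t = 0" if tT: "t \<in> T" for t
      proof -
        obtain x y where t: "t = rho x y" "covered_by x y"
          using tT T by (meson edge_vectorsE subsetD)
        then have t: "t = node_vector x - node_vector y"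
          by (simp add: rho_cover)
        have "t \<in> Z.span T"
          using tT by (rule Z.span_base)
        then have "node_vector x \<in> Z.span T \<longleftrightarrow> node_vector y \<in> Z.span T"
          using t Z.span_add_eq[of t T "node_vector y"] by simp
        then show ?thesis
          by (simp add: t inner_diff_right node)
      qed
      then have "span T \<subseteq> {v. z \<bullet> v = 0}"
        by (intro span_minimal subspace_hyperplane) auto
      then have "z \<bullet> z = 0"
        using \<open>UNIV \<subseteq> span T\<close> by (metis (mono_tags) UNIV_I mem_Collect_eq subsetD)
      then have "z = 0" by simp
      then have "z $ i = 0" by simp
      then show ?thesis
        by (simp add: z_def split: if_splits)
    qed
    then have axis: "int_scale k (axis i 1) \<in> Z.span T" for k i
      by (rule Z.span_scale)
    show "integer_points \<subseteq> Z.span T"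
    proof
      fix v :: "(real, 'n) vec"
      assume "v \<in> integer_points"
      then have "\<forall>i. \<exists>k. v $ i = real_of_int k"
        by (auto simp: integer_points_def Ints_def)
      then obtain k where k: "\<And>i. v $ i = real_of_int (k i)"
        by metis
      have "v = (\<Sum>i\<in>UNIV. int_scale (k i) (axis i 1))"
        by (simp add: vec_eq_iff int_scale_def k axis_component if_distrib cong: if_cong)
      then show "v \<in> Z.span T"
        using axis by (simp add: Z.span_sum)
    qed
  qed
  ultimately show ?thesis
    by (simp add: lattice_basis_def)
qed

lemma int_dependentI:
  assumes v: "v \<in> S" "v \<in> module.span int_scale (S - {v})"
  shows "module.dependent int_scale S"
proof -
  interpret Z: module int_scale by (rule module_int_scale)
  obtain t r where t: "finite t" "t \<subseteq> S - {v}" "v = (\<Sum>a\<in>t. int_scale (r a) a)"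
    using v(2) unfolding Z.span_explicit by blast
  define u where "u = r(v := - 1)"
  have "(\<Sum>a\<in>t. int_scale (u a) a) = v"
    using t by (auto simp: u_def intro!: sum.cong)
  then have "(\<Sum>a\<in>insert v t. int_scale (u a) a) = 0"
    using t by (subst sum.insert) (auto simp: u_def int_scale_def)
  then show ?thesis
    unfolding Z.dependent_explicit using t v(1)
    by (intro exI[of _ "insert v t"] exI[of _ u]) (auto simp: u_def)
qed

lemma int_dependent_imp_dependent:
  assumes "module.dependent int_scale S"
  shows "dependent S"
proof -
  interpret Z: module int_scale by (rule module_int_scale)
  from assms obtain t u where "finite t" "t \<subseteq> S" "(\<Sum>v\<in>t. int_scale (u v) v) = 0" "\<exists>v\<in>t. u v \<noteq> 0"
    unfolding Z.dependent_explicit by blast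
  then show ?thesis
    unfolding dependent_explicit int_scale_def
    by (intro exI[of _ t] exI[of _ "\<lambda>v. real_of_int (u v)"]) auto
qed

text \<open>
  On a hyperplane that misses the origin every linear relation is an affine one: apply the functional
  \<open>a\<close> to see that its coefficients sum to \<open>0\<close>.
\<close>

lemma independent_if_affinely_independent:
  fixes S :: "'a::euclidean_space set"
  assumes "\<not> affine_dependent S" "\<And>v. v \<in> S \<Longrightarrow> a \<bullet> v = 1"
  shows "independent S"
proof
  assume "dependent S"
  moreover have fin: "finite S"
    using assms(1) by (rule aff_independent_finite)
  ultimately obtain u where u: "\<exists>v\<in>S. u v \<noteq> 0" "(\<Sum>v\<in>S. u v *\<^sub>R v) = 0"
    using dependent_finite by blast
  have "(\<Sum>v\<in>S. u v) = (\<Sum>v\<in>S. u v * (a \<bullet> v))"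
    using assms(2) by simp
  also have "\<dots> = a \<bullet> (\<Sum>v\<in>S. u v *\<^sub>R v)"
    by (simp add: inner_sum_right)
  finally have "(\<Sum>v\<in>S. u v) = 0"
    using u(2) by simp
  with assms(1) u fin show False
    by (auto simp: affine_dependent_explicit_finite)
qed

lemma extreme_points_simplex_affinely_independent:
  assumes "k simplex F"
  shows "\<not> affine_dependent {v. v extreme_point_of F}"
proof -
  obtain C where C: "\<not> affine_dependent C" "F = convex hull C"
    using assms by (auto simp: simplex_def)
  then have "{v. v extreme_point_of F} \<subseteq> C"
    using extreme_points_of_convex_hull by auto
  with C(1) show ?thesis
    using affine_dependent_subset by blast
qed

lemma face_of_simplex:
  assumes "k simplex S" "F face_of S"
  shows "\<exists>k. k simplex F"
proof -
  obtain C where C: "\<not> affine_dependent C" "S = convex hull C"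
    using assms by (auto simp: simplex_def)
  then obtain c where "c \<subseteq> C" "F = convex hull c"
    using assms(2) face_of_convex_hull_affine_independent by blast
  with C(1) have "(int (card c) - 1) simplex F"
    using affine_dependent_subset by (auto intro!: simplex_convex_hull)
  then show ?thesis ..
qed

section \<open>Smoothness and factoriality in terms of facets\<close>

lemma
  assumes ind: "\<And>F. F facet_of (convex hull (edge_vectors :: (real, 'n::{finite,order}) vec set)) \<Longrightarrow>
      independent {v. v extreme_point_of F}"
  shows smooth_if_facets_independent: "smooth_fano (convex hull (edge_vectors :: (real, 'n::{finite,order}) vec set))"
    and Q_factorial_if_facets_independent: "Q_factorial_fano (convex hull (edge_vectors :: (real, 'n::{finite,order}) vec set))"
proof -
  let ?Q = "convex hull (edge_vectors :: (real, 'n) vec set)"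
  have "lattice_basis {v. v extreme_point_of F}" if F: "F facet_of ?Q" for F
  proof -
    obtain T where "T \<subseteq> edge_vectors" "{v. v extreme_point_of F} = T" "CARD('n) \<le> card T"
      using F by (rule poset_polytope_facetE)
    with ind[OF F] show ?thesis
      using lattice_basis_if_independent_edge_vectors by blast
  qed
  then show "smooth_fano ?Q"
    by (simp add: smooth_fano_def fano_poset_polytope)
  have "\<exists>k. k simplex G" if G: "G face_of ?Q" "G \<noteq> ?Q" for G
  proof (cases "G = {}")
    case True
    then show ?thesis by (metis simplex_empty)
  next
    case False
    have "polyhedron ?Q"
      by (intro polytope_imp_polyhedron polytope_convex_hull finite_edge_vectors)
    then obtain F where F: "F facet_of ?Q" "G \<subseteq> F"
      using face_of_polyhedron_subset_facet G False by metis
    obtain T where T: "F = convex hull T" "{v. v extreme_point_of F} = T"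
      using F(1) by (rule poset_polytope_facetE)
    then have "\<not> affine_dependent T"
      using ind[OF F(1)] affine_dependent_imp_dependent by auto
    then have "(int (card T) - 1) simplex F"
      by (auto simp: T(1) intro!: simplex_convex_hull)
    moreover have "G face_of F"
      using F facet_of_imp_subset G(1) by (metis face_of_subset)
    ultimately show ?thesis
      by (rule face_of_simplex)
  qed
  then show "Q_factorial_fano ?Q"
    by (simp add: Q_factorial_fano_def fano_poset_polytope)
qed

text \<open>
  An integer relation is in particular a real one, so it contradicts both properties at once.
\<close>

lemma
  fixes F :: "(real, 'n::{finite,order}) vec set"
  assumes F: "F facet_of (convex hull edge_vectors)"
    and dep: "module.dependent int_scale {v. v extreme_point_of F}"
  shows not_smooth_if_facet_dependent: "\<not> smooth_fano (convex hull (edge_vectors :: (real, 'n) vec set))"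
    and not_Q_factorial_if_facet_dependent: "\<not> Q_factorial_fano (convex hull (edge_vectors :: (real, 'n) vec set))"
proof -
  show "\<not> smooth_fano (convex hull (edge_vectors :: (real, 'n) vec set))"
    using F dep by (auto simp: smooth_fano_def lattice_basis_def)
  obtain T a where T: "{v. v extreme_point_of F} = T" "\<And>v. v \<in> T \<Longrightarrow> a \<bullet> v = 1"
    using poset_polytope_facetE[OF F] by metis
  have "\<not> k simplex F" for k
    using extreme_points_simplex_affinely_independent[of k F] independent_if_affinely_independent[of T a]
      int_dependent_imp_dependent[OF dep] T by auto
  moreover have "F face_of convex hull edge_vectors" "F \<noteq> convex hull edge_vectors"
    using F facet_of_irrefl by (auto simp: facet_of_imp_face_of)
  ultimately show "\<not> Q_factorial_fano (convex hull (edge_vectors :: (real, 'n) vec set))"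
    by (auto simp: Q_factorial_fano_def)
qed

section \<open>Cycles in finite graphs\<close>

lemma cycle_if_path_end_extends:
  assumes irrefl: "\<And>x. \<not> E x x"
    and p: "distinct p" "successively E p" "2 \<le> length p"
    and maximal: "\<And>q. \<lbrakk>distinct q; successively E q\<rbrakk> \<Longrightarrow> length q \<le> length p"
    and other: "\<And>y. E (last p) y \<Longrightarrow> \<exists>z. z \<noteq> y \<and> E (last p) z"
    and sym: "\<And>x y. E x y \<Longrightarrow> E y x"
  obtains c where "distinct c" "successively E c" "3 \<le> length c" "E (last c) (hd c)"
proof -
  obtain p' y x where p': "p = p' @ [y, x]"
  proof -
    from p(3) obtain r x where "p = r @ [x]" by (cases p rule: rev_cases) auto
    moreover with p(3) obtain r' y where "r = r' @ [y]" by (cases r rule: rev_cases) auto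
    ultimately show ?thesis using that by simp
  qed
  then have "E y x"
    using p(2) by (simp add: successively_append_iff)
  then obtain z where z: "z \<noteq> y" "E x z"
    using other[of y] sym p' by auto
  have "z \<in> set p"
  proof (rule ccontr)
    assume "z \<notin> set p"
    with p z(2) have "distinct (p @ [z])" "successively E (p @ [z])"
      by (auto simp: p' successively_append_iff)
    from maximal[OF this] show False by simp
  qed
  then have "z \<in> set p'"
    using z irrefl[of x] by (auto simp: p')
  then obtain a b where "p' = a @ z # b"
    by (meson split_list)
  with p p' z show ?thesis
    by (intro that[of "z # b @ [y, x]"]) (auto simp: successively_append_iff)
qed

text \<open>
  Take a longest path. By maximality, an end outside \<open>B\<close> has all its neighbours on the path, and a second
  neighbour closes a cycle.
\<close>

lemma cycle_or_path_between_ends: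
  fixes E :: "'a::finite \<Rightarrow> 'a \<Rightarrow> bool"
  assumes sym: "\<And>x y. E x y \<Longrightarrow> E y x" and irrefl: "\<And>x. \<not> E x x"
    and edge: "E u v"
    and other: "\<And>x y. \<lbrakk>E x y; x \<notin> B\<rbrakk> \<Longrightarrow> \<exists>z. z \<noteq> y \<and> E x z"
  obtains c where "distinct c" "successively E c" "3 \<le> length c" "E (last c) (hd c)"
  | p where "distinct p" "successively E p" "2 \<le> length p" "hd p \<in> B" "last p \<in> B"
proof -
  let ?P = "\<lambda>p. distinct p \<and> successively E p"
  have "?P [u, v]"
    using edge irrefl by auto
  moreover have "length p < Suc (card (UNIV :: 'a set))" if "?P p" for p
    using that distinct_card[of p] card_mono[of UNIV "set p"] by (simp add: less_Suc_eq_le)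
  ultimately obtain p where p: "?P p" and maximal: "\<And>q. ?P q \<Longrightarrow> length q \<le> length p"
    using ex_has_greatest_nat[of ?P "[u, v]" length] by metis
  have len: "2 \<le> length p"
    using maximal[OF \<open>?P [u, v]\<close>] by simp
  have rev: "successively E (rev q) \<longleftrightarrow> successively E q" for q
    using sym successively_mono[of _ q] by (auto simp: successively_rev)
  consider "last p \<notin> B" | "last (rev p) \<notin> B" | "hd p \<in> B" "last p \<in> B"
    using len by (auto simp: last_rev)
  then show ?thesis
  proof cases
    case 1
    show ?thesis
    proof (rule cycle_if_path_end_extends[of E p])
      show "\<exists>z. z \<noteq> y \<and> E (last p) z" if "E (last p) y" for y
        using other that 1 by blast
      show "E x y \<Longrightarrow> E y x" for x y
        by (rule sym)
    qed (use p len maximal irrefl that(1) in \<open>simp_all add: that(1)\<close>)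
  next
    case 2
    show ?thesis
    proof (rule cycle_if_path_end_extends[of E "rev p"])
      show "\<exists>z. z \<noteq> y \<and> E (last (rev p)) z" if "E (last (rev p)) y" for y
        using other that 2 by blast
      show "E x y \<Longrightarrow> E y x" for x y
        by (rule sym)
      show "successively E (rev p)"
        using p rev by simp
    qed (use p len maximal irrefl that(1) in \<open>simp_all add: that(1)\<close>)
  next
    case 3
    with p len show ?thesis using that(2) by blast
  qed
qed

lemma subpath_between:
  assumes sym: "\<And>x y. E x y \<Longrightarrow> E y x"
    and p: "distinct p" "successively E p" "u \<in> set p" "v \<in> set p" "u \<noteq> v"
  obtains q where "q \<noteq> []" "distinct q" "successively E q" "hd q = u" "last q = v"
proof -
  have rev: "successively E (rev q) \<longleftrightarrow> successively E q" for q
    using sym successively_mono[of _ q] by (auto simp: successively_rev)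
  obtain xs ys where xs: "p = xs @ u # ys"
    using p(3) by (meson split_list)
  with p(4,5) consider "v \<in> set ys" | "v \<in> set xs" by auto
  then show ?thesis
  proof cases
    case 1
    then obtain ys' zs where "ys = ys' @ v # zs" by (meson split_list)
    with p xs show ?thesis
      by (intro that[of "u # ys' @ [v]"]) (auto simp: successively_append_iff successively_Cons hd_append)
  next
    case 2
    then obtain xs' zs where "xs = xs' @ v # zs" by (meson split_list)
    with p xs have "distinct (v # zs @ [u])" "successively E (v # zs @ [u])"
      by (auto simp: successively_append_iff successively_Cons hd_append)
    then show ?thesis
      using rev[of "v # zs @ [u]"] by (intro that[of "rev (v # zs @ [u])"]) auto
  qed
qed

lemma successively_path_steps: "successively P p \<longleftrightarrow> (\<forall>(x, y) \<in> set (path_steps p). P x y)"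
  by (induction p rule: induct_list012) auto

section \<open>Tight cycles and paths\<close>

lemma tight_sym: "tight h x y \<longleftrightarrow> tight h y x"
  by (auto simp: tight_def)

lemma tight_hasse_edge: "tight h x y \<Longrightarrow> hasse_edge x y"
  by (auto simp: tight_def hasse_edge_def)

lemma tight_step_sign: "tight h x y \<Longrightarrow> h y = h x + real_of_int (step_sign x y)"
  by (auto simp: tight_def step_sign_def covered_by_def)

lemma height_function_step:
  assumes "height_function S s \<mu>" "(x, y) \<in> set s"
  shows "x < y \<Longrightarrow> \<mu> y = \<mu> x + 1" "y < x \<Longrightarrow> \<mu> x = \<mu> y + 1"
  using assms unfolding height_function_def by blast+

lemma tight_if_height_function:
  assumes "height_function S s \<mu>" "(x, y) \<in> set s" "hasse_edge x y" "h x = real (\<mu> x)" "h y = real (\<mu> y)"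
  shows "tight h x y"
proof -
  from assms(3) consider "covered_by x y" | "covered_by y x"
    by (auto simp: hasse_edge_def)
  then show ?thesis
  proof cases
    case 1
    then have "\<mu> y = \<mu> x + 1"
      using height_function_step(1)[OF assms(1,2)] by (simp add: covered_by_def)
    with 1 show ?thesis by (simp add: tight_def assms(4,5))
  next
    case 2
    then have "\<mu> x = \<mu> y + 1"
      using height_function_step(2)[OF assms(1,2)] by (simp add: covered_by_def)
    with 2 show ?thesis by (simp add: tight_def assms(4,5))
  qed
qed

lemma tight_path_telescope:
  assumes "p \<noteq> []" "successively (tight h) p"
  shows "h (last p) = h (hd p) + real_of_int (\<Sum>(x, y)\<leftarrow>path_steps p. step_sign x y)"
  using assms by (induction p rule: induct_list012) (auto simp: tight_step_sign)

text \<open>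
  A potential and the height function have the same increments along a tight path. The latter takes
  natural numbers as values, whereas the potential of a facet is only known to be real.
\<close>

lemma tight_path_height_function:
  assumes \<mu>: "height_function S s \<mu>" and sub: "set (path_steps p) \<subseteq> set s"
    and p: "successively (tight h) p" and x: "x \<in> set p"
  shows "real (\<mu> x) - h x = real (\<mu> (hd p)) - h (hd p)"
  using sub p x
proof (induction p rule: induct_list012)
  case (3 a b p)
  have "tight h a b" "(a, b) \<in> set s"
    using 3 by auto
  then have "real (\<mu> a) - h a = real (\<mu> b) - h b"
    using height_function_step[OF \<mu> \<open>(a, b) \<in> set s\<close>] unfolding tight_def covered_by_def by fastforce
  with 3 show ?case by auto
qed auto

text \<open>
  The obstructions of the theorem, and their counterparts that refer to a potential instead of the
  height function and the distances.
\<close>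

definition obstructing_cycle :: "'n::{finite,order} extended list \<Rightarrow> bool" where
  "obstructing_cycle C \<longleftrightarrow> very_special_cycle C \<and>
     (\<forall>a<length C. \<forall>b<length C. C ! b < C ! a \<longrightarrow>
        int (mu_cycle C (C ! a)) - int (mu_cycle C (C ! b)) \<le> int (poset_dist (C ! b) (C ! a))) \<and>
     (\<forall>a<length C. \<forall>b<length C.
        int (mu_cycle C (C ! a)) - int (mu_cycle C (C ! b))
          \<le> int (poset_dist Minf (C ! a)) + int (poset_dist (C ! b) Pinf))"

definition obstructing_path :: "'n::{finite,order} extended list \<Rightarrow> bool" where
  "obstructing_path \<Gamma> \<longleftrightarrow> special_path \<Gamma> \<and> hd \<Gamma> = Minf \<and> last \<Gamma> = Pinf \<and>
     (\<forall>a<length \<Gamma>. \<forall>b<length \<Gamma>. \<Gamma> ! b < \<Gamma> ! a \<longrightarrow>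
        int (mu_path \<Gamma> (\<Gamma> ! a)) - int (mu_path \<Gamma> (\<Gamma> ! b)) \<le> int (poset_dist (\<Gamma> ! b) (\<Gamma> ! a)))"

definition tight_cycle :: "('n::{finite,order} extended \<Rightarrow> real) \<Rightarrow> 'n extended list \<Rightarrow> bool" where
  "tight_cycle h C \<longleftrightarrow> distinct C \<and> 3 \<le> length C \<and> successively (tight h) C \<and> tight h (last C) (hd C) \<and>
     \<not> {Minf, Pinf} \<subseteq> set C"

definition tight_path :: "('n::{finite,order} extended \<Rightarrow> real) \<Rightarrow> 'n extended list \<Rightarrow> bool" where
  "tight_path h \<Gamma> \<longleftrightarrow> \<Gamma> \<noteq> [] \<and> distinct \<Gamma> \<and> successively (tight h) \<Gamma> \<and> hd \<Gamma> = Minf \<and> last \<Gamma> = Pinf"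

lemma mu_cycle_height_function:
  "very_special_cycle C \<Longrightarrow> height_function (set C) (cycle_steps C) (mu_cycle C)"
  unfolding mu_cycle_def by (rule theI'[OF mu_cycle_unique]) (simp add: very_special_cycle_def)

lemma mu_path_height_function:
  "special_path p \<Longrightarrow> height_function (set p) (path_steps p) (mu_path p)"
  unfolding mu_path_def by (rule theI'[OF mu_path_unique])

text \<open>
  Going up from \<open>y\<close> to \<open>Pinf\<close> and then from \<open>Minf\<close> to \<open>x\<close> is possible for any two nodes, comparable
  or not.
\<close>

lemma potential_wrap:
  fixes h :: "'n::{finite,order} extended \<Rightarrow> real"
  assumes "potential h"
  shows "h x \<le> h y + real (poset_dist y Pinf) + real (poset_dist Minf x)"
  using potential_le_dist[OF assms, of y Pinf] potential_le_dist[OF assms, of Minf x] assms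
  by (simp add: potential_def)

lemma obstructing_cycle_if_tight:
  assumes h: "potential h" and C: "tight_cycle h C"
  shows "obstructing_cycle C"
proof -
  have ne: "C \<noteq> []" using C by (auto simp: tight_cycle_def)
  have "h (hd C) = h (last C) + real_of_int (step_sign (last C) (hd C))"
    using C by (simp add: tight_cycle_def tight_step_sign)
  moreover have "h (last C) = h (hd C) + real_of_int (\<Sum>(x, y)\<leftarrow>path_steps C. step_sign x y)"
    using C ne by (intro tight_path_telescope) (auto simp: tight_cycle_def)
  ultimately have "real_of_int (\<Sum>(x, y)\<leftarrow>cycle_steps C. step_sign x y) = 0"
    by (simp add: cycle_steps_eq[OF ne])
  then have "balanced (cycle_steps C)"
    unfolding balanced_iff by linarith
  moreover have "successively hasse_edge C"
    using C successively_mono[of "tight h" C hasse_edge] tight_hasse_edge by (auto simp: tight_cycle_def)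
  moreover have "hasse_edge (hd C) (last C)"
    using C tight_hasse_edge tight_sym by (metis tight_cycle_def)
  ultimately have vs: "very_special_cycle C"
    using C ne by (simp add: very_special_cycle_def special_cycle_def hasse_cycle_def hasse_path_def
      tight_cycle_def)
  then have \<mu>: "height_function (set C) (cycle_steps C) (mu_cycle C)"
    by (rule mu_cycle_height_function)
  have offset: "real (mu_cycle C x) - h x = real (mu_cycle C (hd C)) - h (hd C)" if "x \<in> set C" for x
    by (rule tight_path_height_function[OF \<mu> _ _ that]) (use C in \<open>auto simp: tight_cycle_def cycle_steps_eq[OF ne]\<close>)
  have diff: "real (mu_cycle C x) - real (mu_cycle C y) = h x - h y" if "x \<in> set C" "y \<in> set C" for x y
    using offset[of x] offset[of y] that by linarith
  have "int (mu_cycle C x) - int (mu_cycle C y) \<le> int (poset_dist y x)" if "x \<in> set C" "y \<in> set C" "y < x" for x y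
  proof -
    have "real_of_int (int (mu_cycle C x) - int (mu_cycle C y)) \<le> real_of_int (int (poset_dist y x))"
      using diff[OF that(1,2)] potential_le_dist[OF h order.strict_implies_order[OF that(3)]] by simp
    then show ?thesis
      by (simp only: of_int_le_iff)
  qed
  moreover have "int (mu_cycle C x) - int (mu_cycle C y) \<le> int (poset_dist Minf x) + int (poset_dist y Pinf)" if "x \<in> set C" "y \<in> set C" for x y
  proof -
    have "real_of_int (int (mu_cycle C x) - int (mu_cycle C y))
        \<le> real_of_int (int (poset_dist Minf x) + int (poset_dist y Pinf))"
      using diff[OF that] potential_wrap[OF h, of x y] by simp
    then show ?thesis
      by (simp only: of_int_le_iff)
  qed
  ultimately show ?thesis
    using vs by (simp add: obstructing_cycle_def)
qed

lemma obstructing_path_if_tight: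
  assumes h: "potential h" and p: "tight_path h p"
  shows "obstructing_path p"
proof -
  have ne: "p \<noteq> []" using p by (auto simp: tight_path_def)
  have "h (last p) = h (hd p) + real_of_int (\<Sum>(x, y)\<leftarrow>path_steps p. step_sign x y)"
    using p by (intro tight_path_telescope) (auto simp: tight_path_def)
  then have "real_of_int (\<Sum>(x, y)\<leftarrow>path_steps p. step_sign x y) = 0"
    using h p by (simp add: potential_def tight_path_def)
  then have "balanced (path_steps p)"
    unfolding balanced_iff by linarith
  moreover have "successively hasse_edge p"
    using p successively_mono[of "tight h" p hasse_edge] tight_hasse_edge by (auto simp: tight_path_def)
  ultimately have sp: "special_path p"
    using p by (simp add: special_path_def hasse_path_def tight_path_def)
  then have \<mu>: "height_function (set p) (path_steps p) (mu_path p)"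
    by (rule mu_path_height_function)
  have offset: "real (mu_path p x) - h x = real (mu_path p (hd p)) - h (hd p)" if "x \<in> set p" for x
    by (rule tight_path_height_function[OF \<mu> _ _ that]) (use p in \<open>auto simp: tight_path_def\<close>)
  have diff: "real (mu_path p x) - real (mu_path p y) = h x - h y" if "x \<in> set p" "y \<in> set p" for x y
    using offset[of x] offset[of y] that by linarith
  have "int (mu_path p x) - int (mu_path p y) \<le> int (poset_dist y x)" if "x \<in> set p" "y \<in> set p" "y < x" for x y
  proof -
    have "real_of_int (int (mu_path p x) - int (mu_path p y)) \<le> real_of_int (int (poset_dist y x))"
      using diff[OF that(1,2)] potential_le_dist[OF h order.strict_implies_order[OF that(3)]] by simp
    then show ?thesis
      by (simp only: of_int_le_iff)
  qed
  then show ?thesis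
    using sp p by (simp add: obstructing_path_def tight_path_def)
qed

lemma tight_if_obstructing_cycle:
  assumes C: "obstructing_cycle C"
  obtains h where "potential h" "tight_cycle h C"
proof -
  let ?\<mu> = "mu_cycle C"
  have vs: "very_special_cycle C"
    using C by (simp add: obstructing_cycle_def)
  then have ne: "C \<noteq> []" and hasse: "successively hasse_edge C" "hasse_edge (last C) (hd C)"
      and dist: "distinct C" "3 \<le> length C" and ends: "\<not> {Minf, Pinf} \<subseteq> set C"
    by (auto simp: very_special_cycle_def special_cycle_def hasse_cycle_def hasse_path_def hasse_edge_def)
  have \<mu>: "height_function (set C) (cycle_steps C) ?\<mu>"
    using vs by (rule mu_cycle_height_function)
  obtain h where h: "potential (\<lambda>v. real (h v))" "\<And>x. x \<in> set C \<Longrightarrow> h x = ?\<mu> x"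
  proof (rule potential_extension[of "set C" ?\<mu>])
    show "?\<mu> a \<le> ?\<mu> b + poset_dist b a" if "a \<in> set C" "b \<in> set C" "b < a" for a b
      using C that by (fastforce simp: obstructing_cycle_def in_set_conv_nth)
    show "?\<mu> a \<le> ?\<mu> b + poset_dist b Pinf + poset_dist Minf a" if "a \<in> set C" "b \<in> set C" for a b
      using C that by (fastforce simp: obstructing_cycle_def in_set_conv_nth)
  qed (use ne ends in auto)
  have "tight (\<lambda>v. real (h v)) x y" if "(x, y) \<in> set (cycle_steps C)" for x y
  proof (rule tight_if_height_function[OF \<mu> that])
    show "hasse_edge x y"
      using that hasse by (auto simp: cycle_steps_eq[OF ne] successively_path_steps)
    have "x \<in> set C" "y \<in> set C"
      using that path_steps_subset[of C] ne by (auto simp: cycle_steps_eq[OF ne])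
    then show "real (h x) = real (?\<mu> x)" "real (h y) = real (?\<mu> y)"
      using h(2) by auto
  qed
  then have "tight_cycle (\<lambda>v. real (h v)) C"
    using dist ends by (auto simp add: tight_cycle_def successively_path_steps cycle_steps_eq[OF ne])
  with h(1) show ?thesis by (rule that)
qed

text \<open>
  For a path from \<open>Minf\<close> to \<open>Pinf\<close> the inequality for walks through the bounds follows from the other
  one: both bounds lie on the path, and they have the same height because the path is special.
\<close>

lemma tight_if_obstructing_path:
  assumes p: "obstructing_path p"
  obtains h where "potential h" "tight_path h p"
proof -
  let ?\<mu> = "mu_path p"
  have sp: "special_path p" and ends: "hd p = Minf" "last p = Pinf"
    using p by (simp_all add: obstructing_path_def)
  then have ne: "p \<noteq> []" and hasse: "successively hasse_edge p" and dist: "distinct p"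
    by (auto simp: special_path_def hasse_path_def)
  then have mem: "Minf \<in> set p" "Pinf \<in> set p"
    using ends by (metis hd_in_set, metis last_in_set)
  have \<mu>: "height_function (set p) (path_steps p) ?\<mu>"
    using sp by (rule mu_path_height_function)
  have "\<forall>(x, y) \<in> set (path_steps p). int (?\<mu> y) = int (?\<mu> x) + step_sign x y"
    using \<mu> path_steps_comparable[OF hasse] by (fastforce simp: height_function_def step_sign_def)
  from path_height_telescope[OF ne this] have eq: "?\<mu> Minf = ?\<mu> Pinf"
    using sp ends by (simp add: special_path_def balanced_iff)
  have up: "?\<mu> a \<le> ?\<mu> b + poset_dist b a" if "a \<in> set p" "b \<in> set p" "b \<le> a" for a b
  proof (cases "a = b")
    case False
    then show ?thesis
      using p that by (fastforce simp: obstructing_path_def in_set_conv_nth order.strict_iff_order)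
  qed simp
  obtain h where h: "potential (\<lambda>v. real (h v))" "\<And>x. x \<in> set p \<Longrightarrow> h x = ?\<mu> x"
  proof (rule potential_extension[of "set p" ?\<mu>])
    show "?\<mu> a \<le> ?\<mu> b + poset_dist b Pinf + poset_dist Minf a" if "a \<in> set p" "b \<in> set p" for a b
      using up[of a Minf] up[of Pinf b] eq that mem by simp
  qed (use ne eq up in auto)
  have "tight (\<lambda>v. real (h v)) x y" if "(x, y) \<in> set (path_steps p)" for x y
  proof (rule tight_if_height_function[OF \<mu> that])
    show "hasse_edge x y"
      using that hasse by (auto simp: successively_path_steps)
    have "x \<in> set p" "y \<in> set p"
      using that path_steps_subset[of p] by auto
    then show "real (h x) = real (?\<mu> x)" "real (h y) = real (?\<mu> y)"
      using h(2) by auto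
  qed
  then have "tight_path (\<lambda>v. real (h v)) p"
    using dist ne ends by (auto simp add: tight_path_def successively_path_steps)
  with h(1) show ?thesis by (rule that)
qed

section \<open>Dependent facets are those with tight cycles or paths\<close>

text \<open>
  In a linear relation between the edge vectors, the \<open>i\<close>-th coordinates say that what flows into the
  node \<open>Fin i\<close> flows out again. So an edge with nonzero coefficient never ends alone at such a node,
  and these edges contain a cycle or a path between the two bounds. A cycle through both
  bounds contains such a path.
\<close>

lemma dependent_edge_vectors_graph:
  fixes T :: "(real, 'n::{finite,order}) vec set"
  assumes T: "T \<subseteq> edge_vectors" and dep: "dependent T"
    and tight: "\<And>x y. \<lbrakk>covered_by x y; rho x y \<in> T\<rbrakk> \<Longrightarrow> h y = h x + 1"
  shows "\<exists>p. tight_cycle h p \<or> tight_path h p"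
proof -
  have finT: "finite T"
    using T finite_edge_vectors finite_subset by blast
  then obtain c where c: "\<exists>v\<in>T. c v \<noteq> 0" "(\<Sum>v\<in>T. c v *\<^sub>R v) = 0"
    using dep dependent_finite by blast
  \<comment> \<open>the edges in the support of the relation, directed and undirected\<close>
  define D where "D x y \<longleftrightarrow> covered_by x y \<and> rho x y \<in> T \<and> c (rho x y) \<noteq> 0" for x y
  define E where "E x y \<longleftrightarrow> D x y \<or> D y x" for x y
  have sym: "E x y \<Longrightarrow> E y x" for x y
    by (auto simp: E_def)
  have E_tight: "E x y \<Longrightarrow> tight h x y" for x y
    using tight by (auto simp: E_def D_def tight_def)
  have other: "\<exists>z. z \<noteq> y \<and> E x z" if xy: "E x y" and x: "x \<notin> {Minf, Pinf}" for x y
  proof -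
    from x obtain i where i: "x = Fin i" by (cases x) auto
    obtain t where t: "t \<in> T" "c t \<noteq> 0" "D x y \<and> t = rho x y \<or> D y x \<and> t = rho y x"
      using xy by (auto simp: E_def D_def)
    have "t $ i \<noteq> 0"
      using t(3) by (cases y) (auto simp: D_def i axis_component split: if_splits)
    have "c t * t $ i + (\<Sum>v\<in>T - {t}. c v * v $ i) = (\<Sum>v\<in>T. c v *\<^sub>R v) $ i"
      using sum.remove[OF finT t(1), of "\<lambda>v. c v * v $ i"] by simp
    then have "(\<Sum>v\<in>T - {t}. c v * v $ i) \<noteq> 0"
      using c(2) t(2) \<open>t $ i \<noteq> 0\<close> by auto
    then obtain s where s: "s \<in> T" "s \<noteq> t" "c s \<noteq> 0" "s $ i \<noteq> 0"
      by (force elim: sum.not_neutral_contains_not_neutral)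
    obtain a b where ab: "s = rho a b" "covered_by a b"
      using s(1) T by (meson edge_vectorsE subsetD)
    then have "D a b"
      using s by (simp add: D_def)
    have "a = x \<or> b = x"
      using s(4) ab by (cases a; cases b) (auto simp: i axis_component split: if_splits)
    moreover have "\<not> (covered_by x y \<and> covered_by y x)"
      by (auto simp: covered_by_def)
    ultimately show ?thesis
      using \<open>D a b\<close> t(3) s(2) ab by (auto simp: E_def D_def)
  qed
  obtain w where w: "w \<in> T" "c w \<noteq> 0"
    using c(1) by blast
  then obtain a b where "w = rho a b" "covered_by a b"
    using T by (meson edge_vectorsE subsetD)
  then have edge: "E a b"
    using w by (simp add: E_def D_def)
  have irrefl: "\<not> E x x" for x
    by (simp add: E_def D_def)
  consider C where "tight_cycle h C"
    | p where "distinct p" "successively E p" "{Minf, Pinf} \<subseteq> set p"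
  proof (rule cycle_or_path_between_ends[of E, OF sym irrefl edge other])
    fix C
    assume C: "distinct C" "successively E C" "3 \<le> length C" "E (last C) (hd C)"
    show ?thesis
    proof (cases "{Minf, Pinf} \<subseteq> set C")
      case False
      then have "tight_cycle h C"
        using C E_tight by (auto simp: tight_cycle_def elim!: successively_mono)
      then show ?thesis by (rule that(1))
    qed (use C that(2) in blast)
  next
    fix p
    assume p: "distinct p" "successively E p" "2 \<le> length p"
      "hd p \<in> {Minf, Pinf}" "last p \<in> {Minf, Pinf}"
    have "hd p \<noteq> last p"
      using p(1,3) by (cases p) (auto split: if_splits)
    moreover have "hd p \<in> set p" "last p \<in> set p"
      using p(3) by (auto intro!: hd_in_set last_in_set)
    ultimately have "{Minf, Pinf} \<subseteq> set p"
      using p(4,5) by auto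
    with p(1,2) show ?thesis by (rule that(2))
  qed
  then show ?thesis
  proof cases
    case (2 p)
    obtain q where "q \<noteq> []" "distinct q" "successively E q" "hd q = Minf" "last q = Pinf"
      using subpath_between[of E p Minf Pinf] sym 2 by auto
    then have "tight_path h q"
      using E_tight by (auto simp: tight_path_def elim!: successively_mono)
    then show ?thesis by blast
  qed blast
qed

definition unoriented_rho :: "'n::{finite,order} extended \<Rightarrow> 'n extended \<Rightarrow> (real, 'n) vec" where
  "unoriented_rho x y = (if covered_by x y then rho x y else rho y x)"

lemma unoriented_rho_cases:
  assumes "hasse_edge x y"
  obtains "covered_by x y" "unoriented_rho x y = rho x y"
  | "covered_by y x" "unoriented_rho x y = rho y x"
proof (cases "covered_by x y")
  case False
  with assms have "covered_by y x"
    by (simp add: hasse_edge_def)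
  with False show ?thesis
    by (simp add: that(2) unoriented_rho_def)
qed (simp add: that(1) unoriented_rho_def)

lemma unoriented_rho_inject:
  assumes "hasse_edge x y" "hasse_edge x' y'" "unoriented_rho x y = unoriented_rho x' y'"
  shows "x = x' \<and> y = y' \<or> x = y' \<and> y = x'"
proof -
  obtain a b where ab: "covered_by a b" "unoriented_rho x y = rho a b" "a = x \<and> b = y \<or> a = y \<and> b = x"
    using assms(1) by (rule unoriented_rho_cases) auto
  obtain a' b' where ab': "covered_by a' b'" "unoriented_rho x' y' = rho a' b'"
      "a' = x' \<and> b' = y' \<or> a' = y' \<and> b' = x'"
    using assms(2) by (rule unoriented_rho_cases) auto
  have "a = a' \<and> b = b'"
    using rho_inject[OF ab(1) ab'(1)] ab(2) ab'(2) assms(3) by simp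
  with ab(3) ab'(3) show ?thesis by auto
qed

lemma node_diff_in_span:
  assumes "hasse_edge x y" "unoriented_rho x y \<in> W"
  shows "node_vector x - node_vector y \<in> module.span int_scale W"
proof -
  interpret Z: module int_scale by (rule module_int_scale)
  have "unoriented_rho x y \<in> Z.span W"
    using assms(2) by (rule Z.span_base)
  then show ?thesis
    using assms(1) Z.span_neg[of "unoriented_rho x y" W]
    by (auto simp: unoriented_rho_def rho_cover hasse_edge_def split: if_splits)
qed

lemma path_node_diff_in_span:
  assumes "p \<noteq> []" "successively hasse_edge p"
    "\<And>x y. (x, y) \<in> set (path_steps p) \<Longrightarrow> unoriented_rho x y \<in> W"
  shows "node_vector (hd p) - node_vector (last p) \<in> module.span int_scale W"
  using assms
proof (induction p rule: induct_list012)
  case (3 x y p)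
  interpret Z: module int_scale by (rule module_int_scale)
  have "node_vector x - node_vector y \<in> Z.span W"
    using 3 by (intro node_diff_in_span) auto
  moreover have "node_vector y - node_vector (last (y # p)) \<in> Z.span W"
    using 3 by auto
  ultimately show ?case
    using Z.span_add[of "node_vector x - node_vector y" W "node_vector y - node_vector (last (y # p))"]
    by (simp del: last.simps) (simp add: split: if_splits)
next
  case 1 then show ?case by simp
next
  case (2 x)
  then show ?case using module.span_zero[OF module_int_scale] by simp
qed

text \<open>
  A cycle of length \<open>2\<close> would use its only edge twice; from length \<open>3\<close> on, the closing edge is new.
\<close>

lemma closing_step_new:
  assumes "distinct c" "3 \<le> length c" "(x, y) \<in> set (path_steps c)"
  shows "(x, y) \<noteq> (last c, hd c)" "(x, y) \<noteq> (hd c, last c)"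
proof -
  obtain a b d r where c: "c = a # b # d # r"
    using assms(2) by (cases c rule: list.exhaust; cases "tl c"; cases "tl (tl c)") auto
  have "a \<notin> snd ` set (path_steps c)"
    using assms(1) path_steps_subset[of "b # d # r"] by (auto simp: c)
  then show "(x, y) \<noteq> (last c, hd c)"
    using assms(3) by (force simp: c)
  show "(x, y) \<noteq> (hd c, last c)"
  proof
    assume eq: "(x, y) = (hd c, last c)"
    have "(a, y) \<notin> set (path_steps (b # d # r))" for y
      using assms(1) path_steps_subset[of "b # d # r"] by (auto simp: c)
    with eq assms(3) have "last (d # r) = b"
      by (auto simp: c split: if_splits)
    then have "b \<in> set (d # r)"
      by (metis last_in_set list.discI)
    with assms(1) show False by (simp add: c)
  qed
qed

text \<open>
  The differences of node vectors telescope around the cycle, which writes the vector of the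
  closing edge as an integer combination of the others.
\<close>

lemma tight_cycle_dependent:
  assumes C: "tight_cycle h C" and S: "\<And>x y. tight h x y \<Longrightarrow> unoriented_rho x y \<in> S"
  shows "module.dependent int_scale S"
proof (rule int_dependentI)
  interpret Z: module "int_scale :: _ \<Rightarrow> (real, 'a) vec \<Rightarrow> _" by (rule module_int_scale)
  let ?v = "unoriented_rho (last C) (hd C)"
  have C': "C \<noteq> []" "distinct C" "3 \<le> length C" "successively (tight h) C" "tight h (last C) (hd C)"
    using C by (auto simp: tight_cycle_def)
  show "?v \<in> S"
    using S C'(5) .
  have "unoriented_rho x y \<in> S - {?v}" if "(x, y) \<in> set (path_steps C)" for x y
  proof -
    have "tight h x y"
      using C'(4) that by (auto simp: successively_path_steps)
    then show ?thesis
      using S unoriented_rho_inject[of x y "last C" "hd C"] closing_step_new[OF C'(2,3) that]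
        C'(5) tight_hasse_edge[of h] by auto
  qed
  then have "node_vector (hd C) - node_vector (last C) \<in> Z.span (S - {?v})"
    using C' by (intro path_node_diff_in_span) (auto elim!: successively_mono intro: tight_hasse_edge)
  then show "?v \<in> Z.span (S - {?v})"
    using C'(5) Z.span_neg[of "node_vector (hd C) - node_vector (last C)" "S - {?v}"]
    by (auto simp: unoriented_rho_def rho_cover tight_def)
qed

lemma tight_path_Cons:
  assumes "tight_path h p"
  obtains y q where "p = Minf # y # q"
proof -
  obtain q where "p = Minf # q"
    using assms by (cases p) (auto simp: tight_path_def)
  moreover then have "q \<noteq> []"
    using assms by (auto simp: tight_path_def)
  ultimately show ?thesis
    using that by (cases q) auto
qed

text \<open>
  The node vectors of both bounds are \<open>0\<close>, so the steps of the path sum to \<open>0\<close> up to signs. No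
  later step visits \<open>Minf\<close> again, so the first edge vector differs from all others.
\<close>

lemma tight_path_dependent:
  assumes p: "tight_path h p" and S: "\<And>x y. tight h x y \<Longrightarrow> unoriented_rho x y \<in> S"
  shows "module.dependent int_scale S"
proof -
  interpret Z: module "int_scale :: _ \<Rightarrow> (real, 'a) vec \<Rightarrow> _" by (rule module_int_scale)
  obtain y q where q: "p = Minf # y # q"
    using p by (rule tight_path_Cons)
  have q': "distinct p" "tight h Minf y" "successively (tight h) (y # q)" "last (y # q) = Pinf"
    using p by (auto simp: tight_path_def q)
  let ?v = "unoriented_rho Minf y"
  have v: "?v = - node_vector y"
    using q'(2) by (auto simp: unoriented_rho_def rho_cover tight_def)
  have "unoriented_rho a b \<in> S - {?v}" if "(a, b) \<in> set (path_steps (y # q))" for a b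
  proof -
    have "tight h a b"
      using q'(3) that by (auto simp: successively_path_steps)
    moreover have "a \<noteq> Minf" "b \<noteq> Minf"
      using path_steps_subset[of "y # q"] that q'(1) by (auto simp: q)
    ultimately show ?thesis
      using S unoriented_rho_inject[of a b Minf y] q'(2) tight_hasse_edge[of h] by auto
  qed
  then have "node_vector (hd (y # q)) - node_vector (last (y # q)) \<in> Z.span (S - {?v})"
    using q'(3) by (intro path_node_diff_in_span) (auto elim!: successively_mono intro: tight_hasse_edge)
  then have "?v \<in> Z.span (S - {?v})"
    using Z.span_neg[of "node_vector y" "S - {?v}"] q'(4) by (simp add: v)
  then show ?thesis
    using S[OF q'(2)] by (rule int_dependentI[rotated])
qed

lemma dependent_facet_if_tight:
  fixes h :: "'n::{finite,order} extended \<Rightarrow> real"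
  assumes h: "potential h" and p: "tight_cycle h p \<or> tight_path h p"
  obtains F :: "(real, 'n) vec set" where "F facet_of (convex hull edge_vectors)"
    "module.dependent int_scale {v. v extreme_point_of F}"
proof -
  obtain u v where "tight h u v"
    using p
  proof
    assume path: "tight_path h p"
    then obtain y q where "p = Minf # y # q"
      by (rule tight_path_Cons)
    with path show ?thesis
      using that by (auto simp: tight_path_def)
  qed (auto simp: tight_cycle_def)
  then obtain u v where "covered_by u v" "h v = h u + 1"
    by (auto simp: tight_def)
  then obtain F where F: "F facet_of (convex hull edge_vectors)"
      "\<And>x y. \<lbrakk>covered_by x y; h y = h x + 1\<rbrakk> \<Longrightarrow> rho x y extreme_point_of F"
    using tight_facet_exists[OF h] by metis
  have "unoriented_rho x y \<in> {v. v extreme_point_of F}" if "tight h x y" for x y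
    using that F(2) by (auto simp: tight_def unoriented_rho_def covered_by_def)
  then have "module.dependent int_scale {v. v extreme_point_of F}"
    using p tight_cycle_dependent tight_path_dependent by blast
  with F(1) show ?thesis by (rule that)
qed

theorem theorem2p3:
  shows "(Q_factorial_fano (poset_polytope TYPE('n::{finite,order}))
      \<longleftrightarrow> smooth_fano (poset_polytope TYPE('n::{finite,order}))) \<and>
    (smooth_fano (poset_polytope TYPE('n::{finite,order})) \<longleftrightarrow>
      \<not> (\<exists>C :: 'n::{finite,order} extended list. very_special_cycle C \<and>
          (\<forall>a<length C. \<forall>b<length C. C ! b < C ! a \<longrightarrow>
             int (mu_cycle C (C ! a)) - int (mu_cycle C (C ! b))
               \<le> int (poset_dist (C ! b) (C ! a))) \<and>
          (\<forall>a<length C. \<forall>b<length C.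
             int (mu_cycle C (C ! a)) - int (mu_cycle C (C ! b))
               \<le> int (poset_dist Minf (C ! a)) + int (poset_dist (C ! b) Pinf))) \<and>
      \<not> (\<exists>\<Gamma> :: 'n::{finite,order} extended list. special_path \<Gamma> \<and> hd \<Gamma> = Minf \<and> last \<Gamma> = Pinf \<and>
          (\<forall>a<length \<Gamma>. \<forall>b<length \<Gamma>. \<Gamma> ! b < \<Gamma> ! a \<longrightarrow>
             int (mu_path \<Gamma> (\<Gamma> ! a)) - int (mu_path \<Gamma> (\<Gamma> ! b))
               \<le> int (poset_dist (\<Gamma> ! b) (\<Gamma> ! a)))))"
proof -
  let ?Q = "poset_polytope TYPE('n)"
  let ?obstruction = "\<exists>p :: 'n extended list. obstructing_cycle p \<or> obstructing_path p"
  have "\<not> smooth_fano ?Q \<and> \<not> Q_factorial_fano ?Q" if ob: ?obstruction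
  proof -
    obtain h :: "'n extended \<Rightarrow> real" and p where "potential h" "tight_cycle h p \<or> tight_path h p"
      using ob tight_if_obstructing_cycle tight_if_obstructing_path by metis
    then obtain F :: "(real, 'n) vec set" where "F facet_of (convex hull edge_vectors)"
        "module.dependent int_scale {v. v extreme_point_of F}"
      by (rule dependent_facet_if_tight)
    then show ?thesis
      unfolding poset_polytope_eq
      using not_smooth_if_facet_dependent not_Q_factorial_if_facet_dependent by blast
  qed
  moreover have "smooth_fano ?Q \<and> Q_factorial_fano ?Q" if no: "\<not> ?obstruction"
  proof -
    have "independent {v. v extreme_point_of F}"
      if F: "F facet_of (convex hull (edge_vectors :: (real, 'n) vec set))" for F
    proof
      assume dep: "dependent {v. v extreme_point_of F}"
      from F obtain T h where T: "T \<subseteq> edge_vectors" "{v. v extreme_point_of F} = T" "potential h"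
          "\<And>x y. \<lbrakk>covered_by x y; rho x y \<in> T\<rbrakk> \<Longrightarrow> h y = h x + 1"
        by (rule poset_polytope_facetE) (rule that)
      then have "\<exists>p. tight_cycle h p \<or> tight_path h p"
        using dep by (intro dependent_edge_vectors_graph) auto
      with no T(3) show False
        using obstructing_cycle_if_tight obstructing_path_if_tight by blast
    qed
    then show ?thesis
      unfolding poset_polytope_eq
      using smooth_if_facets_independent Q_factorial_if_facets_independent by blast
  qed
  ultimately have "Q_factorial_fano ?Q \<longleftrightarrow> smooth_fano ?Q"
    and "smooth_fano ?Q \<longleftrightarrow> \<not> (\<exists>C :: 'n extended list. obstructing_cycle C) \<and>
           \<not> (\<exists>\<Gamma> :: 'n extended list. obstructing_path \<Gamma>)"
    by blast+
  then show ?thesis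
    unfolding obstructing_cycle_def obstructing_path_def by (intro conjI)
qed

end
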